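(* Let $H_1$ and $H_2$ be Hilbert spaces, and let $S\in L(H_1,H_2)$ and $T\in L(H_2,H_1)$ be such that $R(TS)$ and $R(ST)$ are finite dimensional subspaces of $H_1$ and $H_2$ respectively. Then the following statements are equivalent: (i) $(S,T)$ is a Fredholm pair; (ii) $S+T^*\in L(H_1,H_2)$ is a Fredholm operator; (iii) $T+S^*\in L(H_2,H_1)$ is a Fredholm operator. Furthermore, in this case $\operatorname{ind}(S,T)=\operatorname{ind}(S+T^* )=-\operatorname{ind}(T+S^* )$.
   Context: For Hilbert spaces $H_1,H_2$, $L(H_1,H_2)$ denotes the bounded linear maps from $H_1$ to $H_2$. $N(\cdot)$ and $R(\cdot)$ denote null space and range, and $*$ the Hilbert space adjoint. A pair $(S,T)$ with $S\in L(H_1,H_2)$, $T\in L(H_2,H_1)$ is called a Fredholm pair if the following dimensions are all finite: $a=\dim N(S)/(N(S)\cap R(T))$, $b=\dim R(T)/(N(S)\cap R(T))$, $c=\dim N(T)/(N(T)\cap R(S))$, $d=\dim R(S)/(N(T)\cap R(S))$. The index of a Fredholm pair is $\operatorname{ind}(S,T)=a-b-c+d$. The index of a Fredholm operator $A\in L(X,Y)$ is the usual one, $\operatorname{ind}(A)=\dim N(A)-\dim Y/R(A)$. *)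

theory Defs
  imports "HOL-Analysis.Analysis" "HOL-Library.Set_Algebras"
begin

section \<open>The scalar field\<close>

text \<open>
  Hilbert spaces are taken over a scalar field which is either the reals or the complex numbers.
  Both are instances of the following class. There are no other scalar fields: the axioms imply
  that every \<open>x\<close> is a root of the real polynomial \<open>(X - x) (X - scalar_cnj x)\<close>, so that the field
  is algebraic over the reals.
\<close>

class real_or_complex_field = real_normed_field +
  fixes scalar_cnj :: "'a \<Rightarrow> 'a"
  assumes scalar_cnj_add: "scalar_cnj (x + y) = scalar_cnj x + scalar_cnj y"
    and mult_scalar_cnj_scaleR: "x * scalar_cnj x = (norm x)\<^sup>2 *\<^sub>R 1"

lemma mult_scalar_cnj:
  "x * scalar_cnj x = of_real ((norm x)\<^sup>2)" for x :: "'k::real_or_complex_field"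
  by (simp only: mult_scalar_cnj_scaleR of_real_def)

instantiation real :: real_or_complex_field
begin

definition scalar_cnj_real :: "real \<Rightarrow> real" where "scalar_cnj_real x = x"

instance
  by standard (simp_all add: scalar_cnj_real_def power2_eq_square)

end

instantiation complex :: real_or_complex_field
begin

definition scalar_cnj_complex :: "complex \<Rightarrow> complex" where "scalar_cnj_complex = cnj"

instance
  by standard (simp_all add: scalar_cnj_complex_def complex_norm_square[symmetric] scaleR_conv_of_real del: of_real_power)

end

lemma scalar_cnj_0 [simp]: "scalar_cnj (0::'k::real_or_complex_field) = 0"
  using scalar_cnj_add[of "0::'k" 0] by simp

lemma scalar_cnj_of_real [simp]:
  "scalar_cnj (of_real r :: 'k::real_or_complex_field) = of_real r"
proof (cases "r = 0")
  case False
  then show ?thesis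
    using mult_scalar_cnj[of "of_real r :: 'k"] by (simp add: power2_eq_square)
qed simp

lemma add_scalar_cnj_in_Reals: "x + scalar_cnj x \<in> (\<real> :: 'k::real_or_complex_field set)"
proof -
  have "scalar_cnj (1::'k) = 1"
    using scalar_cnj_of_real[of 1] by simp
  then have "(x + 1) * (scalar_cnj x + 1) = of_real ((norm (x + 1))\<^sup>2)"
    using mult_scalar_cnj[of "x + 1"] by (simp add: scalar_cnj_add)
  then have "x + scalar_cnj x = of_real ((norm (x + 1))\<^sup>2 - (norm x)\<^sup>2 - 1)"
    using mult_scalar_cnj[of x] by (simp add: algebra_simps)
  then show ?thesis
    by (metis Reals_of_real)
qed

section \<open>Hilbert spaces and bounded operators\<close>

text \<open>
  The underlying real Banach space (its norm, metric and completeness) is given by the type; the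
  locale adds the scalar multiplication and an inner product which is linear in its first argument
  and induces the norm.
\<close>

locale hilbert_space = vector_space scale
  for scale :: "'k::real_or_complex_field \<Rightarrow> 'a::banach \<Rightarrow> 'a" +
  fixes ip :: "'a \<Rightarrow> 'a \<Rightarrow> 'k"
  assumes scale_of_real: "scale (of_real r) x = r *\<^sub>R x"
    and ip_add_left: "ip (x + y) z = ip x z + ip y z"
    and ip_scale_left: "ip (scale a x) y = a * ip x y"
    and ip_commute: "ip y x = scalar_cnj (ip x y)"
    and ip_self: "ip x x = of_real ((norm x)\<^sup>2)"

definition bounded_operator ::
    "('k::real_normed_field \<Rightarrow> 'a::real_normed_vector \<Rightarrow> 'a) \<Rightarrow>
     ('k \<Rightarrow> 'b::real_normed_vector \<Rightarrow> 'b) \<Rightarrow> ('a \<Rightarrow> 'b) \<Rightarrow> bool"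
  where "bounded_operator s1 s2 A \<longleftrightarrow> Vector_Spaces.linear s1 s2 A \<and> bounded_linear A"

text \<open>
  The Hilbert space adjoint of \<open>A\<close> from the space with inner product \<open>ip1\<close> to the one with inner
  product \<open>ip2\<close>. (The constant \<open>adjoint\<close> of the library is tied to the real inner product of the
  class \<open>real_inner\<close>.)
\<close>

definition hilbert_adjoint ::
    "('a \<Rightarrow> 'a \<Rightarrow> 'k) \<Rightarrow> ('b \<Rightarrow> 'b \<Rightarrow> 'k) \<Rightarrow> ('a \<Rightarrow> 'b) \<Rightarrow> 'b \<Rightarrow> 'a"
  where "hilbert_adjoint ip1 ip2 A = (THE B. \<forall>x y. ip2 (A x) y = ip1 x (B y))"

definition null_space :: "('a \<Rightarrow> 'b::zero) \<Rightarrow> 'a set"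
  where "null_space A = {x. A x = 0}"

section \<open>Dimensions of subspaces and of quotient spaces\<close>

definition fin_dim :: "('k::field \<Rightarrow> 'a::ab_group_add \<Rightarrow> 'a) \<Rightarrow> 'a set \<Rightarrow> bool"
  where "fin_dim s V \<longleftrightarrow> (\<exists>B. finite B \<and> module.span s B = V)"

text \<open>The quotient \<open>V / W\<close>, as a set of cosets; it is used for subspaces \<open>W \<subseteq> V\<close>.\<close>

definition quotient_space :: "'a::plus set \<Rightarrow> 'a set \<Rightarrow> 'a set set"
  where "quotient_space V W = (\<lambda>v. v +o W) ` V"

text \<open>
  The linear combination of finitely many cosets with coefficients \<open>c\<close>, computed by means of the
  elementwise operations on sets. Adding \<open>W\<close> accounts for the zero scalar (as \<open>0\<close> times a coset
  must be \<open>W\<close> and not \<open>{0}\<close>) and for the empty combination.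
\<close>

definition coset_combination ::
    "('k::field \<Rightarrow> 'a::ab_group_add \<Rightarrow> 'a) \<Rightarrow>
     'a set \<Rightarrow> ('a set \<Rightarrow> 'k) \<Rightarrow> 'a set set \<Rightarrow> 'a set"
  where "coset_combination s W c \<B> = (\<Sum>C\<in>\<B>. s (c C) ` C) + W"

definition finite_quotient_basis ::
    "('k::field \<Rightarrow> 'a::ab_group_add \<Rightarrow> 'a) \<Rightarrow>
     'a set \<Rightarrow> 'a set \<Rightarrow> 'a set set \<Rightarrow> bool"
  where "finite_quotient_basis s V W \<B> \<longleftrightarrow>
    finite \<B> \<and> \<B> \<subseteq> quotient_space V W \<and>
    (\<forall>c. coset_combination s W c \<B> = W \<longrightarrow> (\<forall>C\<in>\<B>. c C = 0)) \<and>
    (\<forall>Q\<in>quotient_space V W. \<exists>c. Q = coset_combination s W c \<B>)"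

definition fin_dim_quotient ::
    "('k::field \<Rightarrow> 'a::ab_group_add \<Rightarrow> 'a) \<Rightarrow>
     'a set \<Rightarrow> 'a set \<Rightarrow> bool"
  where "fin_dim_quotient s V W \<longleftrightarrow> (\<exists>\<B>. finite_quotient_basis s V W \<B>)"

text \<open>Only meaningful if \<open>fin_dim_quotient s V W\<close> holds.\<close>

definition dim_quotient ::
    "('k::field \<Rightarrow> 'a::ab_group_add \<Rightarrow> 'a) \<Rightarrow>
     'a set \<Rightarrow> 'a set \<Rightarrow> nat"
  where "dim_quotient s V W = card (SOME \<B>. finite_quotient_basis s V W \<B>)"

lemma (in vector_space) coset_combination_reps:
  assumes W: "subspace W" and fin: "finite I" and inj: "inj_on (\<lambda>i. r i +o W) I"
  shows "coset_combination scale W c ((\<lambda>i. r i +o W) ` I) =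
    (\<Sum>i\<in>I. scale (c (r i +o W)) (r i)) +o W"
proof -
  have "(\<Sum>i\<in>I. scale (d i) ` (r i +o W)) + W = (\<Sum>i\<in>I. scale (d i) (r i)) +o W" for d
    using fin
  proof (induction I)
    case empty
    show ?case
      by (auto simp: set_plus_def elt_set_plus_def)
  next
    case (insert j I)
    have scale_coset: "scale a ` (x +o W) + (y +o W) = (scale a x + y) +o W" for a x y
    proof (intro equalityI subsetI)
      fix z assume "z \<in> scale a ` (x +o W) + (y +o W)"
      then obtain u v where "u \<in> W" "v \<in> W" "z = scale a (x + u) + (y + v)"
        by (auto simp: set_plus_def elt_set_plus_def)
      then have "z = (scale a x + y) + (scale a u + v)" "scale a u + v \<in> W"
        using W by (auto simp: scale_right_distrib algebra_simps subspace_add subspace_scale)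
      then show "z \<in> (scale a x + y) +o W"
        by (auto simp: elt_set_plus_def)
    next
      fix z assume "z \<in> (scale a x + y) +o W"
      then obtain v where "v \<in> W" "z = scale a (x + 0) + (y + v)"
        by (auto simp: elt_set_plus_def algebra_simps)
      then show "z \<in> scale a ` (x +o W) + (y +o W)"
        using subspace_0[OF W] by (fastforce simp: set_plus_def elt_set_plus_def)
    qed
    have "(\<Sum>i\<in>insert j I. scale (d i) ` (r i +o W)) + W
        = scale (d j) ` (r j +o W) + ((\<Sum>i\<in>I. scale (d i) ` (r i +o W)) + W)"
      using insert.hyps by (simp add: add.assoc)
    also have "\<dots> = scale (d j) ` (r j +o W) + ((\<Sum>i\<in>I. scale (d i) (r i)) +o W)"
      using insert.IH by simp
    also have "\<dots> = (\<Sum>i\<in>insert j I. scale (d i) (r i)) +o W"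
      using insert.hyps by (simp add: scale_coset)
    finally show ?case .
  qed
  then show ?thesis
    using inj by (simp add: coset_combination_def sum.reindex)
qed

section \<open>Fredholm operators and Fredholm pairs\<close>

definition fredholm_operator ::
    "('k::real_normed_field \<Rightarrow> 'a::real_normed_vector \<Rightarrow> 'a) \<Rightarrow>
     ('k \<Rightarrow> 'b::real_normed_vector \<Rightarrow> 'b) \<Rightarrow> ('a \<Rightarrow> 'b) \<Rightarrow> bool"
  where "fredholm_operator s1 s2 A \<longleftrightarrow>
    bounded_operator s1 s2 A \<and>
    fin_dim s1 (null_space A) \<and>
    fin_dim_quotient s2 UNIV (range A)"

definition operator_index ::
    "('k::field \<Rightarrow> 'a::ab_group_add \<Rightarrow> 'a) \<Rightarrow> ('k \<Rightarrow> 'b::ab_group_add \<Rightarrow> 'b) \<Rightarrow>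
     ('a \<Rightarrow> 'b) \<Rightarrow> int"
  where "operator_index s1 s2 A =
    int (vector_space.dim s1 (null_space A)) - int (dim_quotient s2 UNIV (range A))"

definition fredholm_pair ::
    "('k::real_normed_field \<Rightarrow> 'a::real_normed_vector \<Rightarrow> 'a) \<Rightarrow>
     ('k \<Rightarrow> 'b::real_normed_vector \<Rightarrow> 'b) \<Rightarrow> ('a \<Rightarrow> 'b) \<Rightarrow> ('b \<Rightarrow> 'a) \<Rightarrow> bool"
  where "fredholm_pair s1 s2 S T \<longleftrightarrow>
    bounded_operator s1 s2 S \<and> bounded_operator s2 s1 T \<and>
    fin_dim_quotient s1 (null_space S) (null_space S \<inter> range T) \<and>
    fin_dim_quotient s1 (range T) (null_space S \<inter> range T) \<and>
    fin_dim_quotient s2 (null_space T) (null_space T \<inter> range S) \<and>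
    fin_dim_quotient s2 (range S) (null_space T \<inter> range S)"

definition pair_index ::
    "('k::field \<Rightarrow> 'a::ab_group_add \<Rightarrow> 'a) \<Rightarrow> ('k \<Rightarrow> 'b::ab_group_add \<Rightarrow> 'b) \<Rightarrow>
     ('a \<Rightarrow> 'b) \<Rightarrow> ('b \<Rightarrow> 'a) \<Rightarrow> int"
  where "pair_index s1 s2 S T =
    int (dim_quotient s1 (null_space S) (null_space S \<inter> range T))
    - int (dim_quotient s1 (range T) (null_space S \<inter> range T))
    - int (dim_quotient s2 (null_space T) (null_space T \<inter> range S))
    + int (dim_quotient s2 (range S) (null_space T \<inter> range S))"

end

theory Submission
  imports Defs
begin

text \<open>
  Write \<open>[V : W]\<close> for the relative dimension \<open>dim V / (V \<inter> W) - dim W / (V \<inter> W)\<close> of two commensurable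
  subspaces, that is, subspaces in which \<open>V \<inter> W\<close> has finite codimension. Both Fredholm conditions are
  commensurability conditions, and both indices are sums of relative dimensions:
  \<open>ind (S, T) = [N(S) : R(T)] + [R(S) : N(T)]\<close> and \<open>ind A = [N(A) : 0] + [R(A) : UNIV]\<close>.
  Commensurability is transitive and the relative dimension is additive. If two linear maps \<open>f\<close>, \<open>g\<close>
  agree on a subspace of finite codimension, then their null spaces and their ranges are
  commensurable, and rank-nullity gives \<open>[N(f) : N(g)] + [R(f) : R(g)] = 0\<close>
  (\<open>linear_agree_finite_codim\<close>). Hence changing \<open>S\<close> by an operator of finite rank alters neither the
  Fredholm property nor the index, both for the pair \<open>(S, T)\<close> and for the operator \<open>S + T\<^sup>*\<close>.

  As \<open>T S\<close> and \<open>S T\<close> have finite rank, such a change of \<open>S\<close> achieves \<open>T S = 0\<close> and \<open>S T = 0\<close>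
  (\<open>exact_perturbation_exists\<close>). Then the ranges of \<open>S\<close> and \<open>T\<^sup>*\<close> are orthogonal, so that
  \<open>N(S + T\<^sup>*) = N(S) \<inter> R(T)\<^sup>\<bottom>\<close> and \<open>R(S + T\<^sup>*) = R(S) + R(T\<^sup>*)\<close>. If \<open>R(T)\<close> and \<open>R(T\<^sup>*)\<close> are closed, then
  \<open>N(S + T\<^sup>*)\<close> is a complement of \<open>R(T)\<close> in \<open>N(S)\<close>, and \<open>R(S + T\<^sup>*) = R(S) + N(T)\<^sup>\<bottom>\<close> has the same
  codimension in the whole space as \<open>R(S)\<close> has in \<open>N(T)\<close>; this is the theorem for \<open>S + T\<^sup>*\<close>
  (\<open>fredholm_pair_exact\<close>). That the ranges are closed follows from either Fredholm condition: the
  adjoint of an operator whose range has finite codimension in a closed subspace has closed range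
  (\<open>closed_range_adjoint\<close>, a consequence of the uniform boundedness principle).

  Exchanging \<open>S\<close> and \<open>T\<close> reverses the sign of the index of the pair, which gives the statement about
  \<open>T + S\<^sup>*\<close>.
\<close>

section \<open>Finite-dimensional quotients\<close>

text \<open>
  \<open>V\<close> is contained in \<open>W\<close> up to finitely many dimensions. The subspace \<open>W\<close> may fail to be contained
  in \<open>V\<close>: this makes the relation a preorder, while for subspaces it still says that
  \<open>V / (V \<inter> W)\<close> is finite-dimensional (\<open>finite_over_Int\<close>).
\<close>

definition finite_over :: "('k::field \<Rightarrow> 'a::ab_group_add \<Rightarrow> 'a) \<Rightarrow> 'a set \<Rightarrow> 'a set \<Rightarrow> bool"
  where "finite_over s V W \<longleftrightarrow> (\<exists>F. finite F \<and> V \<subseteq> module.span s (W \<union> F))"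

text \<open>
  Linear independence of the cosets of \<open>B\<close> in a quotient by \<open>W\<close>, expressed by coefficients because
  this form passes directly to combinations of cosets and to preimages under linear maps.
\<close>

definition independent_modulo ::
    "('k::field \<Rightarrow> 'a::ab_group_add \<Rightarrow> 'a) \<Rightarrow> 'a set \<Rightarrow> 'a set \<Rightarrow> bool"
  where "independent_modulo s W B \<longleftrightarrow>
    finite B \<and> (\<forall>c. (\<Sum>b\<in>B. s (c b) b) \<in> W \<longrightarrow> (\<forall>b\<in>B. c b = 0))"

definition relative_basis ::
    "('k::field \<Rightarrow> 'a::ab_group_add \<Rightarrow> 'a) \<Rightarrow> 'a set \<Rightarrow> 'a set \<Rightarrow> 'a set \<Rightarrow> bool"
  where "relative_basis s V W B \<longleftrightarrow>
    B \<subseteq> V \<and> independent_modulo s W B \<and> V \<subseteq> module.span s (W \<union> B)"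

context vector_space
begin

lemma finite_over_subset: "V \<subseteq> W \<Longrightarrow> finite_over scale V W"
  unfolding finite_over_def by (intro exI[of _ "{}"]) (auto intro: span_base)

lemma finite_over_trans:
  assumes "finite_over scale U V" "finite_over scale V W"
  shows "finite_over scale U W"
proof -
  obtain F G where "finite F" "U \<subseteq> span (V \<union> F)" "finite G" "V \<subseteq> span (W \<union> G)"
    using assms by (auto simp: finite_over_def)
  moreover have "span (V \<union> F) \<subseteq> span (W \<union> (F \<union> G))"
  proof (rule span_minimal)
    have "span (W \<union> G) \<subseteq> span (W \<union> (F \<union> G))" by (rule span_mono) auto
    then show "V \<union> F \<subseteq> span (W \<union> (F \<union> G))"
      using \<open>V \<subseteq> span (W \<union> G)\<close> by (auto intro: span_base)
  qed simp
  ultimately show ?thesis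
    unfolding finite_over_def by (intro exI[of _ "F \<union> G"]) auto
qed

lemma in_span_subspace_Un_iff:
  assumes "subspace W"
  shows "x \<in> span (W \<union> B) \<longleftrightarrow> (\<exists>y\<in>span B. x - y \<in> W)"
proof -
  have W: "span W = W" using assms by simp
  show ?thesis
  proof
    assume "x \<in> span (W \<union> B)"
    then obtain w y where "x = w + y" "w \<in> W" "y \<in> span B"
      unfolding span_Un W by blast
    then show "\<exists>y\<in>span B. x - y \<in> W" by (intro bexI[of _ y]) auto
  next
    assume "\<exists>y\<in>span B. x - y \<in> W"
    then obtain y where "y \<in> span B" "x - y \<in> W" by blast
    then show "x \<in> span (W \<union> B)"
      unfolding span_Un W by (intro CollectI exI[of _ "x - y"] exI[of _ y]) simp
  qed
qed

text \<open>
  Subtracting a suitable element of \<open>W\<close> from each \<open>b \<in> B\<close> moves \<open>B\<close> into the span of \<open>F\<close>. As \<open>B\<close> is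
  independent modulo \<open>W\<close>, the modified vectors are still distinct and linearly independent, so that
  the Steinitz bound for the finite set \<open>F\<close> applies even if \<open>W\<close> has infinite dimension.
\<close>

lemma card_independent_modulo_le:
  assumes W: "subspace W" and B: "independent_modulo scale W B"
    and F: "finite F" "B \<subseteq> span (W \<union> F)"
  shows "card B \<le> card F"
proof -
  have "\<forall>b\<in>B. \<exists>y\<in>span F. b - y \<in> W"
    using F(2) in_span_subspace_Un_iff[OF W] by blast
  then obtain f where f: "\<And>b. b \<in> B \<Longrightarrow> f b \<in> span F" "\<And>b. b \<in> B \<Longrightarrow> b - f b \<in> W"
    by metis
  have fin: "finite B" using B by (simp add: independent_modulo_def)
  have zero: "c b = 0" if "(\<Sum>b\<in>B. scale (c b) (f b)) = 0" "b \<in> B" for c b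
  proof -
    have "(\<Sum>b\<in>B. scale (c b) b) = (\<Sum>b\<in>B. scale (c b) (b - f b))"
      using that(1) by (simp add: scale_right_diff_distrib sum_subtractf)
    also have "\<dots> \<in> W"
      using f W by (intro subspace_sum subspace_scale) auto
    finally show ?thesis using B that(2) by (auto simp: independent_modulo_def)
  qed
  have inj: "inj_on f B"
  proof (rule inj_onI, rule ccontr)
    fix a b assume ab: "a \<in> B" "b \<in> B" "f a = f b" "a \<noteq> b"
    define c where "c = (\<lambda>x. (if x = a then 1 else if x = b then -1 else 0) :: 'a)"
    have "(\<Sum>x\<in>B. scale (c x) (f x)) = (\<Sum>x\<in>{a, b}. scale (c x) (f x))"
      using fin ab by (intro sum.mono_neutral_right) (auto simp: c_def)
    also have "\<dots> = 0" using ab by (simp add: c_def)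
    finally have "c a = 0" using ab(1) by (rule zero)
    then show False by (simp add: c_def)
  qed
  have "independent (f ` B)"
  proof (rule independent_if_scalars_zero)
    fix c x assume c: "(\<Sum>x\<in>f ` B. scale (c x) x) = 0" and "x \<in> f ` B"
    then obtain b where "b \<in> B" "x = f b" by blast
    then show "c x = 0"
      using zero[of "c \<circ> f" b] c inj by (simp add: sum.reindex)
  qed (use fin in simp)
  then have "card (f ` B) \<le> card F"
    using independent_span_bound[OF F(1)] f(1) by blast
  then show ?thesis using inj by (simp add: card_image)
qed

lemma independent_modulo_insert:
  assumes W: "subspace W" and B: "independent_modulo scale W B" and v: "v \<notin> span (W \<union> B)"
  shows "independent_modulo scale W (insert v B)"
proof -
  have fin: "finite B" using B by (simp add: independent_modulo_def)
  have vB: "v \<notin> B" using v by (auto intro: span_base)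
  have "\<forall>b\<in>insert v B. c b = 0" if c: "(\<Sum>b\<in>insert v B. scale (c b) b) \<in> W" for c
  proof -
    have s: "scale (c v) v + (\<Sum>b\<in>B. scale (c b) b) \<in> W"
      using c fin vB by simp
    have "c v = 0"
    proof (rule ccontr)
      assume nz: "c v \<noteq> 0"
      let ?y = "(\<Sum>b\<in>B. scale (c b) b)"
      have "scale (inverse (c v)) (scale (c v) v + ?y) \<in> W"
        using s W by (rule_tac subspace_scale)
      then have "v - scale (- inverse (c v)) ?y \<in> W"
        using nz by (simp add: scale_right_distrib)
      moreover have "scale (- inverse (c v)) ?y \<in> span B"
        by (intro span_scale span_sum span_base) auto
      ultimately show False
        using v in_span_subspace_Un_iff[OF W] by blast
    qed
    then show ?thesis using s B by (auto simp: independent_modulo_def)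
  qed
  then show ?thesis using fin by (simp add: independent_modulo_def)
qed

text \<open>
  Subsets of \<open>V\<close> that are independent modulo \<open>W\<close> have bounded size, and one of maximal size spans.
\<close>

lemma relative_basis_exists:
  assumes W: "subspace W" and V: "finite_over scale V W"
  obtains B where "relative_basis scale V W B"
proof -
  obtain F where F: "finite F" "V \<subseteq> span (W \<union> F)"
    using V by (auto simp: finite_over_def)
  let ?P = "\<lambda>B. B \<subseteq> V \<and> independent_modulo scale W B"
  have bound: "\<forall>B. ?P B \<longrightarrow> card B < Suc (card F)"
    using card_independent_modulo_le[OF W _ F(1)] F(2) by (meson le_imp_less_Suc order_trans)
  have "?P {}" by (simp add: independent_modulo_def)
  then obtain B where B: "?P B" and max: "\<And>C. ?P C \<Longrightarrow> card C \<le> card B"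
    using ex_has_greatest_nat[of ?P "{}" card "Suc (card F)"] bound by auto
  have "V \<subseteq> span (W \<union> B)"
  proof (rule ccontr)
    assume "\<not> ?thesis"
    then obtain v where v: "v \<in> V" "v \<notin> span (W \<union> B)" by blast
    then have "?P (insert v B)" using B independent_modulo_insert[OF W] by auto
    then have "card (insert v B) \<le> card B" by (rule max)
    moreover have "v \<notin> B" "finite B" using v B by (auto simp: independent_modulo_def intro: span_base)
    ultimately show False by simp
  qed
  then show thesis using B that by (auto simp: relative_basis_def)
qed

lemma relative_basis_card_unique:
  assumes "subspace W" "relative_basis scale V W B" "relative_basis scale V W C"
  shows "card B = card C"
proof -
  have "card X \<le> card Y" if "relative_basis scale V W X" "relative_basis scale V W Y" for X Y
  proof (rule card_independent_modulo_le[OF assms(1)])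
    show "independent_modulo scale W X" "finite Y" "X \<subseteq> span (W \<union> Y)"
      using that by (auto simp: relative_basis_def independent_modulo_def)
  qed
  then show ?thesis using assms(2,3) by (intro order_antisym) auto
qed

text \<open>
  The coefficients of a coset combination are indexed by cosets. Choosing representatives injectively
  makes these coefficients interchangeable with coefficients indexed by vectors.
\<close>

lemma relative_basis_cosets_iff:
  assumes W: "subspace W" and B: "finite B" "inj_on (\<lambda>b. b +o W) B" "B \<subseteq> V"
    and WV: "subspace V" "W \<subseteq> V"
  shows "finite_quotient_basis scale V W ((\<lambda>b. b +o W) ` B) \<longleftrightarrow> relative_basis scale V W B"
proof -
  let ?q = "\<lambda>b. b +o W"
  have coset_eq: "?q x = ?q y \<longleftrightarrow> x - y \<in> W" for x y
  proof
    assume "?q x = ?q y"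
    moreover have "x \<in> ?q x" using subspace_0[OF W] by (force simp: elt_set_plus_def)
    ultimately show "x - y \<in> W" by (auto simp: elt_set_plus_def)
  next
    assume d: "x - y \<in> W"
    have "?q u \<subseteq> ?q v" if "u - v \<in> W" for u v
    proof
      fix z assume "z \<in> ?q u"
      then obtain w where "w \<in> W" "z = u + w" by (auto simp: elt_set_plus_def)
      then have "z = v + ((u - v) + w)" "(u - v) + w \<in> W"
        using subspace_add[OF W that] by auto
      then show "z \<in> ?q v"
        unfolding elt_set_plus_def by (metis (mono_tags, lifting) mem_Collect_eq)
    qed
    moreover have "y - x \<in> W" using subspace_neg[OF W d] by simp
    ultimately show "?q x = ?q y" using d by blast
  qed
  have coset_W: "?q x = W \<longleftrightarrow> x \<in> W" for x
    using coset_eq[of x 0] by simp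
  have comb: "coset_combination scale W c (?q ` B) = ?q (\<Sum>b\<in>B. scale (c (?q b)) b)" for c
    using coset_combination_reps[OF W B(1,2)] .
  have ex: "\<exists>d. \<forall>b\<in>B. d (?q b) = c b" for c :: "'b \<Rightarrow> 'a"
    using B(2) by (intro exI[of _ "\<lambda>C. c (the_inv_into B ?q C)"]) (simp add: the_inv_into_f_f[OF B(2)])
  have indep: "(\<forall>c. coset_combination scale W c (?q ` B) = W \<longrightarrow> (\<forall>C\<in>?q ` B. c C = 0))
      \<longleftrightarrow> independent_modulo scale W B" (is "?L \<longleftrightarrow> ?R")
  proof
    assume L: ?L
    have "\<forall>b\<in>B. c b = 0" if c: "(\<Sum>b\<in>B. scale (c b) b) \<in> W" for c
    proof -
      obtain d where d: "\<forall>b\<in>B. d (?q b) = c b" using ex by blast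
      then have "(\<Sum>b\<in>B. scale (d (?q b)) b) = (\<Sum>b\<in>B. scale (c b) b)" by simp
      then have "\<forall>C\<in>?q ` B. d C = 0" using L c by (simp add: comb coset_W)
      then show ?thesis using d by simp
    qed
    then show ?R using B(1) by (simp add: independent_modulo_def)
  next
    assume R: ?R
    show ?L
      unfolding comb coset_W using R
      by (auto simp: independent_modulo_def dest!: spec[of _ "\<lambda>b. _ (b +o W)"])
  qed
  have gen: "(\<forall>Q\<in>quotient_space V W. \<exists>c. Q = coset_combination scale W c (?q ` B))
      \<longleftrightarrow> V \<subseteq> span (W \<union> B)" (is "?L \<longleftrightarrow> ?R")
  proof
    assume L: ?L
    show ?R
    proof
      fix v assume "v \<in> V"
      then obtain c where "?q v = ?q (\<Sum>b\<in>B. scale (c (?q b)) b)"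
        using L by (auto simp: quotient_space_def comb)
      then show "v \<in> span (W \<union> B)"
        unfolding in_span_subspace_Un_iff[OF W] coset_eq
        by (rule bexI) (intro span_sum span_scale span_base)
    qed
  next
    assume R: ?R
    show ?L
    proof
      fix Q assume "Q \<in> quotient_space V W"
      then obtain v where v: "v \<in> V" "Q = ?q v" by (auto simp: quotient_space_def)
      then obtain y where y: "y \<in> span B" "v - y \<in> W"
        using R in_span_subspace_Un_iff[OF W] by blast
      then obtain c where c: "y = (\<Sum>b\<in>B. scale (c b) b)"
        using span_finite[OF B(1)] by auto
      obtain d where d: "\<forall>b\<in>B. d (?q b) = c b" using ex by blast
      then have "y = (\<Sum>b\<in>B. scale (d (?q b)) b)" using c by simp
      then have "Q = coset_combination scale W d (?q ` B)"
        using v y by (simp add: comb coset_eq)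
      then show "\<exists>c. Q = coset_combination scale W c (?q ` B)" by (intro exI[of _ d])
    qed
  qed
  show ?thesis
    unfolding finite_quotient_basis_def indep gen relative_basis_def
    using B by (auto simp: quotient_space_def)
qed

lemma relative_basis_inj_on_cosets:
  assumes W: "subspace W" and B: "independent_modulo scale W B"
  shows "inj_on (\<lambda>b. b +o W) B"
proof (rule inj_onI, rule ccontr)
  fix a b assume ab: "a \<in> B" "b \<in> B" "a +o W = b +o W" "a \<noteq> b"
  have fin: "finite B" using B by (simp add: independent_modulo_def)
  have "a \<in> a +o W" using subspace_0[OF W] by (force simp: elt_set_plus_def)
  then have "a \<in> b +o W" using ab(3) by simp
  then have "a - b \<in> W" by (auto simp: elt_set_plus_def)
  define c where "c = (\<lambda>x. (if x = a then 1 else if x = b then -1 else 0) :: 'a)"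
  have "(\<Sum>x\<in>B. scale (c x) x) = (\<Sum>x\<in>{a, b}. scale (c x) x)"
    using fin ab by (intro sum.mono_neutral_right) (auto simp: c_def)
  also have "\<dots> = a - b" using ab by (simp add: c_def)
  finally have "c a = 0" using B \<open>a - b \<in> W\<close> ab(1) by (auto simp: independent_modulo_def)
  then show False by (simp add: c_def)
qed

lemma finite_quotient_basis_relative_basis:
  assumes W: "subspace W" "subspace V" "W \<subseteq> V" and B: "finite_quotient_basis scale V W \<B>"
  obtains B where "relative_basis scale V W B" "card B = card \<B>"
proof -
  have "\<B> \<subseteq> (\<lambda>v. v +o W) ` V" and fin: "finite \<B>"
    using B by (auto simp: finite_quotient_basis_def quotient_space_def)
  then obtain B where B': "B \<subseteq> V" "inj_on (\<lambda>v. v +o W) B" "\<B> = (\<lambda>v. v +o W) ` B"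
    using subset_image_inj by metis
  moreover have "finite B" using fin B' by (simp add: finite_image_iff)
  ultimately show thesis
    using that[of B] relative_basis_cosets_iff[OF W(1), of B V] W B by (simp add: card_image)
qed

lemma relative_basis_finite_quotient_basis:
  assumes W: "subspace W" "subspace V" "W \<subseteq> V" and B: "relative_basis scale V W B"
  shows "finite_quotient_basis scale V W ((\<lambda>b. b +o W) ` B)"
proof -
  have B': "finite B" "B \<subseteq> V" "independent_modulo scale W B"
    using B by (auto simp: relative_basis_def independent_modulo_def)
  show ?thesis
    using relative_basis_cosets_iff[OF W(1) B'(1) relative_basis_inj_on_cosets[OF W(1) B'(3)] B'(2) W(2,3)] B
    by simp
qed

lemma dim_quotient_eq_card:
  assumes W: "subspace W" "subspace V" "W \<subseteq> V" and B: "relative_basis scale V W B"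
  shows "dim_quotient scale V W = card B"
proof -
  have "finite_quotient_basis scale V W (SOME \<B>. finite_quotient_basis scale V W \<B>)"
    using relative_basis_finite_quotient_basis[OF W B]
    by (rule someI[of "finite_quotient_basis scale V W"])
  then obtain C where C: "relative_basis scale V W C"
      "card C = card (SOME \<B>. finite_quotient_basis scale V W \<B>)"
    by (rule finite_quotient_basis_relative_basis[OF W])
  show ?thesis
    unfolding dim_quotient_def C(2)[symmetric] by (rule relative_basis_card_unique[OF W(1) C(1) B])
qed

lemma fin_dim_quotient_iff:
  assumes W: "subspace W" "subspace V" "W \<subseteq> V"
  shows "fin_dim_quotient scale V W \<longleftrightarrow> finite_over scale V W"
proof
  assume "fin_dim_quotient scale V W"
  then obtain \<B> where "finite_quotient_basis scale V W \<B>"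
    unfolding fin_dim_quotient_def by (elim exE)
  then obtain B where "relative_basis scale V W B"
    by (rule finite_quotient_basis_relative_basis[OF W])
  then show "finite_over scale V W"
    unfolding relative_basis_def independent_modulo_def finite_over_def by blast
next
  assume "finite_over scale V W"
  then obtain B where B: "relative_basis scale V W B"
    using relative_basis_exists[OF W(1)] by blast
  show "fin_dim_quotient scale V W"
    unfolding fin_dim_quotient_def
    using relative_basis_finite_quotient_basis[OF W B] by (intro exI[of _ "(\<lambda>b. b +o W) ` B"])
qed

end

section \<open>Commensurable subspaces and their relative dimension\<close>

definition commensurable :: "('k::field \<Rightarrow> 'a::ab_group_add \<Rightarrow> 'a) \<Rightarrow> 'a set \<Rightarrow> 'a set \<Rightarrow> bool"
  where "commensurable s V W \<longleftrightarrow> finite_over s V W \<and> finite_over s W V"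

definition relative_dim :: "('k::field \<Rightarrow> 'a::ab_group_add \<Rightarrow> 'a) \<Rightarrow> 'a set \<Rightarrow> 'a set \<Rightarrow> int"
  where "relative_dim s V W =
    int (dim_quotient s V (V \<inter> W)) - int (dim_quotient s W (V \<inter> W))"

lemma commensurable_commute: "commensurable s V W \<longleftrightarrow> commensurable s W V"
  by (auto simp: commensurable_def)

context vector_space
begin

lemma commensurable_trans:
  "commensurable scale U V \<Longrightarrow> commensurable scale V W \<Longrightarrow> commensurable scale U W"
  unfolding commensurable_def by (meson finite_over_trans)

lemma commensurable_cong:
  "commensurable scale U V \<Longrightarrow> commensurable scale U W \<longleftrightarrow> commensurable scale V W"
  using commensurable_trans[of U V W] commensurable_trans[of V U W] commensurable_commute[of scale U V]
  by blast

lemma finite_over_mono: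
  "finite_over scale V W \<Longrightarrow> V' \<subseteq> V \<Longrightarrow> W \<subseteq> W' \<Longrightarrow> finite_over scale V' W'"
  by (meson finite_over_subset finite_over_trans)

text \<open>
  The vectors by which \<open>W\<close> is extended to cover \<open>V\<close> can be taken from \<open>V\<close> itself, namely from a
  relative basis; the remaining difference then lies in \<open>V\<close> as well as in \<open>W\<close>.
\<close>

lemma finite_over_Int:
  assumes V: "subspace V" and W: "subspace W" and VW: "finite_over scale V W"
  shows "finite_over scale V (V \<inter> W)"
proof -
  obtain B where B: "relative_basis scale V W B"
    using relative_basis_exists[OF W VW] .
  then have fin: "finite B" and BV: "B \<subseteq> V" and gen: "V \<subseteq> span (W \<union> B)"
    by (auto simp: relative_basis_def independent_modulo_def)
  have "V \<subseteq> span ((V \<inter> W) \<union> B)"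
  proof
    fix v assume v: "v \<in> V"
    then obtain y where y: "y \<in> span B" "v - y \<in> W"
      using gen in_span_subspace_Un_iff[OF W] by blast
    have "y \<in> V" using y(1) span_minimal[OF BV V] by blast
    then have "v - y \<in> V \<inter> W" using y v V by (simp add: subspace_diff)
    then show "v \<in> span ((V \<inter> W) \<union> B)"
      using y(1) in_span_subspace_Un_iff[OF subspace_inter[OF V W]] by blast
  qed
  then show ?thesis using fin by (auto simp: finite_over_def)
qed

lemma finite_over_Int_UNIV:
  assumes "subspace V" "subspace W" "finite_over scale UNIV V" "finite_over scale UNIV W"
  shows "finite_over scale UNIV (V \<inter> W)"
  using finite_over_Int[OF assms(1,2) finite_over_mono[OF assms(4)]] finite_over_trans[OF assms(3)]
  by simp

lemma independent_modulo_disjoint: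
  assumes W: "subspace W" and B: "independent_modulo scale W B" and "b \<in> B"
  shows "b \<notin> W"
proof
  assume "b \<in> W"
  have "(\<Sum>x\<in>B. scale (if x = b then 1 else 0) x) = (\<Sum>x\<in>{b}. scale (if x = b then 1 else 0) x)"
    using B \<open>b \<in> B\<close> by (intro sum.mono_neutral_right) (auto simp: independent_modulo_def)
  also have "\<dots> = b" by simp
  finally have "(\<Sum>x\<in>B. scale (if x = b then 1 else 0) x) \<in> W" using \<open>b \<in> W\<close> by simp
  moreover have "\<forall>c. (\<Sum>x\<in>B. scale (c x) x) \<in> W \<longrightarrow> (\<forall>x\<in>B. c x = 0)"
    using B by (simp add: independent_modulo_def)
  ultimately have "\<forall>x\<in>B. (if x = b then 1 else 0) = (0::'a)"
    by (elim allE[of _ "\<lambda>x. if x = b then 1 else 0"]) simp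
  then show False using \<open>b \<in> B\<close> by auto
qed

text \<open>
  A relative basis of \<open>U\<close> over \<open>V\<close> and one of \<open>V\<close> over \<open>W\<close> together form one of \<open>U\<close> over \<open>W\<close>.
\<close>

lemma dim_quotient_trans:
  assumes sub: "subspace U" "subspace V" "subspace W" "W \<subseteq> V" "V \<subseteq> U"
    and fin: "finite_over scale U V" "finite_over scale V W"
  shows "dim_quotient scale U W = dim_quotient scale U V + dim_quotient scale V W"
proof -
  obtain B where B: "relative_basis scale U V B" using relative_basis_exists[OF sub(2) fin(1)] .
  obtain C where C: "relative_basis scale V W C" using relative_basis_exists[OF sub(3) fin(2)] .
  have finBC: "finite B" "finite C"
    using B C by (auto simp: relative_basis_def independent_modulo_def)
  have CV: "C \<subseteq> V" using C by (simp add: relative_basis_def)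
  have disj: "B \<inter> C = {}"
    using independent_modulo_disjoint[OF sub(2)] B CV by (auto simp: relative_basis_def)
  have "\<forall>x\<in>B \<union> C. c x = 0" if c: "(\<Sum>x\<in>B \<union> C. scale (c x) x) \<in> W" for c
  proof -
    have s: "(\<Sum>x\<in>B. scale (c x) x) + (\<Sum>x\<in>C. scale (c x) x) \<in> W"
      using c finBC disj by (simp add: sum.union_disjoint)
    have "(\<Sum>x\<in>C. scale (c x) x) \<in> V"
      using CV sub by (intro subspace_sum subspace_scale) auto
    moreover have "(\<Sum>x\<in>B. scale (c x) x) + (\<Sum>x\<in>C. scale (c x) x) \<in> V"
      using s sub by auto
    ultimately have "(\<Sum>x\<in>B. scale (c x) x) \<in> V"
      using subspace_diff[OF sub(2)] by fastforce
    then have cB: "\<forall>x\<in>B. c x = 0"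
      using B by (auto simp: relative_basis_def independent_modulo_def)
    then have "(\<Sum>x\<in>C. scale (c x) x) \<in> W" using s by simp
    then have "\<forall>x\<in>C. c x = 0"
      using C by (auto simp: relative_basis_def independent_modulo_def)
    then show ?thesis using cB by blast
  qed
  moreover have "U \<subseteq> span (W \<union> (B \<union> C))"
  proof -
    have "span (W \<union> C) \<subseteq> span (W \<union> (B \<union> C))" by (rule span_mono) auto
    then have "V \<union> B \<subseteq> span (W \<union> (B \<union> C))"
      using C by (auto simp: relative_basis_def intro: span_base)
    then have "span (V \<union> B) \<subseteq> span (W \<union> (B \<union> C))" by (rule span_minimal) simp
    then show ?thesis using B by (auto simp: relative_basis_def)
  qed
  ultimately have BC: "relative_basis scale U W (B \<union> C)"
    using B C finBC sub by (auto simp: relative_basis_def independent_modulo_def)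
  show ?thesis
    using dim_quotient_eq_card[OF _ _ _ BC] dim_quotient_eq_card[OF _ _ _ B]
      dim_quotient_eq_card[OF _ _ _ C] sub finBC disj
    by (simp add: card_Un_disjoint)
qed

text \<open>
  Any common subspace of finite codimension can replace the intersection, because passing from \<open>V \<inter> W\<close>
  to \<open>X\<close> increases both dimensions by the same amount. This is what makes the relative dimension
  additive: three commensurable subspaces can be compared over their common intersection.
\<close>

lemma relative_dim_eq:
  assumes sub: "subspace V" "subspace W" "subspace X" "X \<subseteq> V" "X \<subseteq> W"
    and fin: "finite_over scale V X" "finite_over scale W X"
  shows "relative_dim scale V W = int (dim_quotient scale V X) - int (dim_quotient scale W X)"
proof -
  have I: "subspace (V \<inter> W)" "X \<subseteq> V \<inter> W" "finite_over scale (V \<inter> W) X"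
    "finite_over scale V (V \<inter> W)" "finite_over scale W (V \<inter> W)"
    using sub by (auto intro: subspace_inter finite_over_mono[OF fin(1)] finite_over_mono[OF fin(2)])
  show ?thesis
    unfolding relative_dim_def
    using dim_quotient_trans[OF sub(1) I(1) sub(3) I(2) _ I(4,3)]
      dim_quotient_trans[OF sub(2) I(1) sub(3) I(2) _ I(5,3)] by simp
qed

lemma relative_dim_trans:
  assumes sub: "subspace U" "subspace V" "subspace W"
    and com: "commensurable scale U V" "commensurable scale V W"
  shows "relative_dim scale U W = relative_dim scale U V + relative_dim scale V W"
proof -
  let ?X = "U \<inter> V \<inter> W"
  have UV: "subspace (U \<inter> V)" and X: "subspace ?X" using sub by (auto intro: subspace_inter)
  have "finite_over scale (U \<inter> V) W"
    using com finite_over_mono[of V W "U \<inter> V" W] by (auto simp: commensurable_def)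
  then have UVX: "finite_over scale (U \<inter> V) ?X" by (rule finite_over_Int[OF UV sub(3)])
  have fU: "finite_over scale U ?X"
    using finite_over_Int[OF sub(1,2)] com(1) UVX
    unfolding commensurable_def by (meson finite_over_trans)
  have fV: "finite_over scale V ?X"
    using com(1) fU unfolding commensurable_def by (meson finite_over_trans)
  have fW: "finite_over scale W ?X"
    using com(2) fV unfolding commensurable_def by (meson finite_over_trans)
  have "?X \<subseteq> U" "?X \<subseteq> V" "?X \<subseteq> W" by auto
  then show ?thesis
    using relative_dim_eq[OF sub(1,2) X _ _ fU fV] relative_dim_eq[OF sub(2,3) X _ _ fV fW]
      relative_dim_eq[OF sub(1,3) X _ _ fU fW] by simp
qed

text \<open>
  This is the isomorphism \<open>V / (V \<inter> W) \<cong> (V + W) / W\<close>: a relative basis for the first quotient serves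
  for the second.
\<close>

lemma dim_quotient_sum_eq:
  assumes sub: "subspace U" "subspace V" "subspace W" "V \<subseteq> U" "W \<subseteq> U"
    and gen: "U \<subseteq> span (V \<union> W)" and fin: "finite_over scale V W"
  shows "dim_quotient scale V (V \<inter> W) = dim_quotient scale U W"
proof -
  have VW: "subspace (V \<inter> W)" using sub by (simp add: subspace_inter)
  obtain B where B: "relative_basis scale V (V \<inter> W) B"
    using relative_basis_exists[OF VW finite_over_Int[OF sub(2,3) fin]] .
  then have BV: "B \<subseteq> V" and V: "V \<subseteq> span ((V \<inter> W) \<union> B)" and ind: "independent_modulo scale (V \<inter> W) B"
    by (auto simp: relative_basis_def)
  have "(\<Sum>b\<in>B. scale (c b) b) \<in> V" for c
    using BV sub(2) by (intro subspace_sum subspace_scale) auto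
  then have "independent_modulo scale W B"
    using ind by (auto simp: independent_modulo_def)
  moreover have "U \<subseteq> span (W \<union> B)"
  proof -
    have "V \<subseteq> span (W \<union> B)"
      using V span_mono[of "(V \<inter> W) \<union> B" "W \<union> B"] by blast
    then have "span (V \<union> W) \<subseteq> span (W \<union> B)"
      by (intro span_minimal) (auto intro: span_base)
    then show ?thesis using gen by blast
  qed
  ultimately have "relative_basis scale U W B"
    using BV sub(4) by (auto simp: relative_basis_def)
  then show ?thesis
    using dim_quotient_eq_card[OF VW sub(2) _ B] dim_quotient_eq_card[OF sub(3,1,5)] by simp
qed

lemma fin_dim_quotient_Int_iff:
  assumes "subspace V" "subspace W"
  shows "fin_dim_quotient scale V (V \<inter> W) \<longleftrightarrow> finite_over scale V W"
proof -
  have "fin_dim_quotient scale V (V \<inter> W) \<longleftrightarrow> finite_over scale V (V \<inter> W)"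
    using assms by (intro fin_dim_quotient_iff subspace_inter) auto
  also have "\<dots> \<longleftrightarrow> finite_over scale V W"
    using finite_over_Int[OF assms] finite_over_mono[of V "V \<inter> W" V W] by auto
  finally show ?thesis .
qed

lemma fin_dim_iff_finite_over_0:
  assumes "subspace V"
  shows "fin_dim scale V \<longleftrightarrow> finite_over scale V {0}"
proof
  assume "fin_dim scale V"
  then obtain B where "finite B" "span B = V" by (auto simp: fin_dim_def)
  then show "finite_over scale V {0}" unfolding finite_over_def by auto
next
  assume "finite_over scale V {0}"
  then obtain B where "relative_basis scale V {0} B"
    using relative_basis_exists by (meson subspace_single_0)
  then have "finite B" "B \<subseteq> V" "V \<subseteq> span B"
    by (auto simp: relative_basis_def independent_modulo_def)
  then show "fin_dim scale V"
    unfolding fin_dim_def using span_subspace[OF _ _ assms] by blast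
qed

lemma dim_eq_dim_quotient_0:
  assumes V: "subspace V" and fin: "finite_over scale V {0}"
  shows "dim V = dim_quotient scale V {0}"
proof -
  obtain B where B: "relative_basis scale V {0} B"
    using relative_basis_exists[OF _ fin] subspace_single_0 by blast
  then have B': "finite B" "B \<subseteq> V" "V \<subseteq> span B"
      "\<And>c. (\<Sum>b\<in>B. scale (c b) b) = 0 \<Longrightarrow> \<forall>b\<in>B. c b = 0"
    by (auto simp: relative_basis_def independent_modulo_def)
  then have "independent B" by (intro independent_if_scalars_zero) auto
  then have "dim V = card B" using B' basis_card_eq_dim by metis
  moreover have "dim_quotient scale V {0} = card B"
    using V B by (intro dim_quotient_eq_card) (auto simp: subspace_0)
  ultimately show ?thesis by simp
qed

lemma dim_quotient_self: "subspace V \<Longrightarrow> dim_quotient scale V V = 0"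
  using dim_quotient_eq_card[of V V "{}"]
  by (auto simp: relative_basis_def independent_modulo_def intro: span_base)

end

section \<open>Linear maps that agree on a subspace of finite codimension\<close>

context Vector_Spaces.linear
begin

lemma subspace_null_space: "vs1.subspace (null_space f)"
  using subspace_kernel by (simp add: null_space_def)

lemma subspace_range: "vs2.subspace (range f)"
  using subspace_image vs1.subspace_UNIV by blast

lemma finite_over_image:
  assumes "finite_over s1 V W"
  shows "finite_over s2 (f ` V) (f ` W)"
proof -
  obtain F where F: "finite F" "V \<subseteq> vs1.span (W \<union> F)"
    using assms by (auto simp: finite_over_def)
  have "f ` V \<subseteq> vs2.span (f ` W \<union> f ` F)"
    using spans_image[OF F(2)] by (simp add: image_Un)
  then show ?thesis using F(1) unfolding finite_over_def by blast
qed

text \<open>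
  Preimages of a finite basis of the range span a complement of the null space.
\<close>

lemma finite_over_UNIV_null_space:
  assumes "finite_over s2 (range f) {0}"
  shows "finite_over s1 UNIV (null_space f)"
proof -
  obtain B where B: "relative_basis s2 (range f) {0} B"
    using vs2.relative_basis_exists[OF vs2.subspace_single_0 assms] .
  then have fin: "finite B" and "B \<subseteq> range f" and gen: "range f \<subseteq> vs2.span B"
    by (auto simp: relative_basis_def independent_modulo_def)
  then obtain C where C: "finite C" "B = f ` C" by (metis finite_subset_image)
  have "x \<in> vs1.span (null_space f \<union> C)" for x
  proof -
    have "f x \<in> f ` vs1.span C" using gen C span_image by auto
    then obtain y where y: "y \<in> vs1.span C" "f x = f y" by blast
    then have "x - y \<in> null_space f" by (simp add: null_space_def diff)
    then show ?thesis
      using vs1.in_span_subspace_Un_iff[OF subspace_null_space] y(1) by blast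
  qed
  then show ?thesis using C(1) unfolding finite_over_def by blast
qed

text \<open>
  Rank-nullity relative to a subspace: a relative basis on the null space, together with preimages of
  a relative basis on the image, is a relative basis of \<open>V\<close> over \<open>W\<close>. All spaces involved may be
  infinite-dimensional.
\<close>

lemma dim_quotient_null_space_image:
  assumes sub: "vs1.subspace V" "vs1.subspace W" "W \<subseteq> V" and fin: "finite_over s1 V W"
  shows "dim_quotient s1 V W =
    dim_quotient s1 (V \<inter> null_space f) (W \<inter> null_space f) + dim_quotient s2 (f ` V) (f ` W)"
proof -
  let ?N = "null_space f"
  have VN: "vs1.subspace (V \<inter> ?N)" and WN: "vs1.subspace (W \<inter> ?N)"
    using sub subspace_null_space by (auto intro: vs1.subspace_inter)
  have "finite_over s1 (V \<inter> ?N) W"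
    by (rule vs1.finite_over_mono[OF fin]) auto
  then have "finite_over s1 (V \<inter> ?N) (V \<inter> ?N \<inter> W)"
    by (rule vs1.finite_over_Int[OF VN sub(2)])
  moreover have "V \<inter> ?N \<inter> W = W \<inter> ?N" using sub(3) by blast
  ultimately have finN: "finite_over s1 (V \<inter> ?N) (W \<inter> ?N)" by simp
  obtain B where B: "relative_basis s1 (V \<inter> ?N) (W \<inter> ?N) B"
    using vs1.relative_basis_exists[OF WN finN] .
  have fW: "vs2.subspace (f ` W)" and fV: "vs2.subspace (f ` V)"
    using sub by (auto intro: subspace_image)
  obtain C' where C': "relative_basis s2 (f ` V) (f ` W) C'"
    using vs2.relative_basis_exists[OF fW finite_over_image[OF fin]] .
  then have "C' \<subseteq> f ` V" by (simp add: relative_basis_def)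
  then obtain C where C: "C \<subseteq> V" "inj_on f C" "C' = f ` C" by (metis subset_image_inj)
  have finBC: "finite B" "finite C"
    using B C' C by (auto simp: relative_basis_def independent_modulo_def finite_image_iff)
  have BN: "f b = 0" "b \<in> V" if "b \<in> B" for b
    using B that by (auto simp: relative_basis_def null_space_def)
  have f_sum: "f (\<Sum>x\<in>C. s1 (c x) x) = (\<Sum>x\<in>C. s2 (c x) (f x))" for c
    by (simp add: sum scale)
  have indC: "\<forall>x\<in>C. c x = 0" if c: "(\<Sum>x\<in>C. s2 (c x) (f x)) \<in> f ` W" for c
  proof
    fix x assume x: "x \<in> C"
    have "(\<Sum>y\<in>f ` C. s2 (c (the_inv_into C f y)) y) = (\<Sum>x\<in>C. s2 (c x) (f x))"
      using C(2) by (simp add: sum.reindex the_inv_into_f_f)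
    moreover have "\<forall>d. (\<Sum>y\<in>f ` C. s2 (d y) y) \<in> f ` W \<longrightarrow> (\<forall>y\<in>f ` C. d y = 0)"
      using C' by (simp add: C(3) relative_basis_def independent_modulo_def)
    ultimately have "\<forall>y\<in>f ` C. c (the_inv_into C f y) = 0"
      using c by (elim allE[of _ "\<lambda>y. c (the_inv_into C f y)"]) simp
    then show "c x = 0" using x C(2) by (simp add: the_inv_into_f_f)
  qed
  have disj: "B \<inter> C = {}"
  proof (rule ccontr)
    assume "B \<inter> C \<noteq> {}"
    then obtain x where x: "x \<in> B" "x \<in> C" by blast
    then have "f x \<in> f ` W" using BN vs2.subspace_0[OF fW] by simp
    then show False
      using vs2.independent_modulo_disjoint[OF fW, of C' "f x"] C' C(3) x(2)
      by (auto simp: relative_basis_def)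
  qed
  have "\<forall>x\<in>B \<union> C. c x = 0" if c: "(\<Sum>x\<in>B \<union> C. s1 (c x) x) \<in> W" for c
  proof -
    have s: "(\<Sum>x\<in>B. s1 (c x) x) + (\<Sum>x\<in>C. s1 (c x) x) \<in> W"
      using c finBC disj by (simp add: sum.union_disjoint)
    have B0: "(\<Sum>x\<in>B. s1 (c x) x) \<in> V \<inter> ?N"
      using B by (intro vs1.subspace_sum[OF VN] vs1.subspace_scale[OF VN]) (auto simp: relative_basis_def)
    have "f ((\<Sum>x\<in>B. s1 (c x) x) + (\<Sum>x\<in>C. s1 (c x) x)) = (\<Sum>x\<in>C. s2 (c x) (f x))"
      using B0 by (simp add: add f_sum null_space_def)
    then have "(\<Sum>x\<in>C. s2 (c x) (f x)) \<in> f ` W"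
      by (rule subst[of _ _ "\<lambda>z. z \<in> f ` W"]) (rule imageI[OF s])
    then have cC: "\<forall>x\<in>C. c x = 0" by (rule indC)
    then have "(\<Sum>x\<in>B. s1 (c x) x) \<in> W \<inter> ?N" using s B0 by simp
    then have "\<forall>x\<in>B. c x = 0"
      using B by (auto simp: relative_basis_def independent_modulo_def)
    then show ?thesis using cC by blast
  qed
  moreover have "V \<subseteq> vs1.span (W \<union> (B \<union> C))"
  proof
    fix v assume v: "v \<in> V"
    then have "f v \<in> vs2.span (f ` W \<union> f ` C)" using C' C(3) by (auto simp: relative_basis_def)
    then have "f v \<in> f ` vs1.span (W \<union> C)" by (simp only: span_image image_Un[symmetric])
    then obtain y where y: "y \<in> vs1.span (W \<union> C)" "f v = f y" by blast
    have "vs1.span (W \<union> C) \<subseteq> V"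
      using sub(1,3) C(1) by (intro vs1.span_minimal) auto
    then have "v - y \<in> V \<inter> ?N" using y v sub(1) by (auto simp: null_space_def diff vs1.subspace_diff)
    then have "v - y \<in> vs1.span ((W \<inter> ?N) \<union> B)" using B by (auto simp: relative_basis_def)
    then have "v - y \<in> vs1.span (W \<union> (B \<union> C))"
      using vs1.span_mono[of "(W \<inter> ?N) \<union> B" "W \<union> (B \<union> C)"] by blast
    moreover have "y \<in> vs1.span (W \<union> (B \<union> C))"
      using y(1) vs1.span_mono[of "W \<union> C" "W \<union> (B \<union> C)"] by blast
    ultimately have "v - y + y \<in> vs1.span (W \<union> (B \<union> C))" by (rule vs1.span_add)
    then show "v \<in> vs1.span (W \<union> (B \<union> C))" by simp
  qed
  ultimately have BC: "relative_basis s1 V W (B \<union> C)"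
    using BN C(1) finBC by (auto simp: relative_basis_def independent_modulo_def)
  have "dim_quotient s1 V W = card (B \<union> C)"
    using vs1.dim_quotient_eq_card[OF sub(2,1,3) BC] .
  moreover have "dim_quotient s1 (V \<inter> ?N) (W \<inter> ?N) = card B"
    using vs1.dim_quotient_eq_card[OF WN VN _ B] sub(3) by blast
  moreover have "dim_quotient s2 (f ` V) (f ` W) = card C'"
    using vs2.dim_quotient_eq_card[OF fW fV _ C'] sub(3) by blast
  ultimately show ?thesis
    using disj finBC C by (simp add: card_Un_disjoint card_image)
qed

end

text \<open>
  Compare both maps with their common restriction to \<open>W\<close>. By rank-nullity, the codimension of the
  null space and that of the image of this restriction, in the null space and range of \<open>f\<close>, add up to
  the codimension of \<open>W\<close>; the same holds for \<open>g\<close>, and subtracting gives the last claim. With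
  \<open>relative_dim_trans\<close>, it yields the stability of all indices under perturbations of finite rank.
\<close>

lemma linear_agree_finite_codim:
  assumes f: "Vector_Spaces.linear s1 s2 f" and g: "Vector_Spaces.linear s1 s2 g"
    and W: "module.subspace s1 W" "finite_over s1 UNIV W" and fg: "\<And>x. x \<in> W \<Longrightarrow> f x = g x"
  shows "commensurable s1 (null_space f) (null_space g)"
    and "commensurable s2 (range f) (range g)"
    and "relative_dim s1 (null_space f) (null_space g) + relative_dim s2 (range f) (range g) = 0"
proof -
  interpret f: Vector_Spaces.linear s1 s2 f by fact
  interpret g: Vector_Spaces.linear s1 s2 g by fact
  let ?X = "W \<inter> null_space f"
  have X: "?X = W \<inter> null_space g" using fg by (auto simp: null_space_def)
  have fgW: "f ` W = g ` W" using fg by (simp add: image_def)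
  have sX: "f.vs1.subspace ?X" by (intro f.vs1.subspace_inter W f.subspace_null_space)
  have N: "finite_over s1 (null_space h) (W \<inter> null_space h)" if "Vector_Spaces.linear s1 s2 h" for h
  proof -
    interpret h: Vector_Spaces.linear s1 s2 h by fact
    have "finite_over s1 (null_space h) W"
      by (rule f.vs1.finite_over_mono[OF W(2)]) auto
    then show ?thesis
      using f.vs1.finite_over_Int[OF h.subspace_null_space W(1)] by (simp add: Int_commute)
  qed
  have fX: "finite_over s1 (null_space f) ?X" and gX: "finite_over s1 (null_space g) ?X"
    using N[OF f] N[OF g] X by auto
  have fR: "finite_over s2 (range f) (f ` W)" and gR: "finite_over s2 (range g) (f ` W)"
    using f.finite_over_image[OF W(2)] g.finite_over_image[OF W(2)] fgW by auto
  have sub: "?X \<subseteq> null_space f" "?X \<subseteq> null_space g" "f ` W \<subseteq> range f" "f ` W \<subseteq> range g"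
    using X image_mono[of W UNIV g] unfolding fgW[symmetric] by auto
  show "commensurable s1 (null_space f) (null_space g)"
    unfolding commensurable_def
    using f.vs1.finite_over_mono[OF fX order_refl sub(2)] f.vs1.finite_over_mono[OF gX order_refl sub(1)] ..
  show "commensurable s2 (range f) (range g)"
    unfolding commensurable_def
    using f.vs2.finite_over_mono[OF fR order_refl sub(4)] f.vs2.finite_over_mono[OF gR order_refl sub(3)] ..
  have "relative_dim s1 (null_space f) (null_space g) =
      int (dim_quotient s1 (null_space f) ?X) - int (dim_quotient s1 (null_space g) ?X)"
    using sub fX gX by (intro f.vs1.relative_dim_eq f.subspace_null_space g.subspace_null_space sX) auto
  moreover have "relative_dim s2 (range f) (range g) =
      int (dim_quotient s2 (range f) (f ` W)) - int (dim_quotient s2 (range g) (f ` W))"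
    using sub fR gR
    by (intro f.vs2.relative_dim_eq f.subspace_range g.subspace_range f.subspace_image W) auto
  moreover have "dim_quotient s1 UNIV W =
      dim_quotient s1 (null_space f) ?X + dim_quotient s2 (range f) (f ` W)"
    using f.dim_quotient_null_space_image[OF _ W(1) _ W(2)] by simp
  moreover have "dim_quotient s1 UNIV W =
      dim_quotient s1 (null_space g) ?X + dim_quotient s2 (range g) (f ` W)"
    using g.dim_quotient_null_space_image[OF _ W(1) _ W(2)] X fgW by simp
  ultimately show
    "relative_dim s1 (null_space f) (null_space g) + relative_dim s2 (range f) (range g) = 0"
    by simp
qed

section \<open>Geometry of Hilbert spaces\<close>

text \<open>
  This formula determines the conjugation by the norm, so that multiplicativity and
  involutivity are inherited from the norm.
\<close>

lemma scalar_cnj_conv_divide: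
  "scalar_cnj x = of_real ((norm x)\<^sup>2) / x" for x :: "'k::real_or_complex_field"
  using mult_scalar_cnj[of x] by (cases "x = 0") (auto simp: field_simps)

lemma norm_scalar_cnj [simp]: "norm (scalar_cnj x) = norm x" for x :: "'k::real_or_complex_field"
  by (cases "x = 0") (auto simp: scalar_cnj_conv_divide norm_divide norm_power power2_eq_square simp flip: of_real_mult)

lemma scalar_cnj_mult: "scalar_cnj (x * y) = scalar_cnj x * scalar_cnj y"
  for x y :: "'k::real_or_complex_field"
  by (simp add: scalar_cnj_conv_divide norm_mult power_mult_distrib)

lemma scalar_cnj_scalar_cnj [simp]: "scalar_cnj (scalar_cnj x) = x"
  for x :: "'k::real_or_complex_field"
proof (cases "x = 0")
  case False
  have "scalar_cnj (scalar_cnj x) = of_real ((norm x)\<^sup>2) / scalar_cnj x"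
    by (simp only: scalar_cnj_conv_divide[of "scalar_cnj x"] norm_scalar_cnj)
  also have "\<dots> = x" using False by (simp add: scalar_cnj_conv_divide)
  finally show ?thesis .
qed simp

lemma scalar_cnj_eq_0_iff [simp]: "scalar_cnj x = 0 \<longleftrightarrow> x = 0" for x :: "'k::real_or_complex_field"
  using norm_scalar_cnj[of x] by (metis norm_eq_zero)

definition orthogonal_complement :: "('a \<Rightarrow> 'a \<Rightarrow> 'k::zero) \<Rightarrow> 'a set \<Rightarrow> 'a set"
  where "orthogonal_complement ip M = {x. \<forall>y\<in>M. ip x y = 0}"

context hilbert_space
begin

lemma ip_add_right: "ip x (y + z) = ip x y + ip x z"
  using ip_commute[of x "y + z"] ip_commute[of x y] ip_commute[of x z]
  by (simp add: ip_add_left scalar_cnj_add)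

lemma ip_scale_right: "ip x (scale a y) = scalar_cnj a * ip x y"
  using ip_commute[of x "scale a y"] ip_commute[of x y]
  by (simp add: ip_scale_left scalar_cnj_mult)

lemma ip_zero_left [simp]: "ip 0 x = 0"
  using ip_scale_left[of 0 0 x] by simp

lemma ip_zero_right [simp]: "ip x 0 = 0"
  using ip_scale_right[of x 0 0] by simp

lemma ip_minus_left: "ip (- x) y = - ip x y"
  using ip_scale_left[of "-1" x y] by simp

lemma ip_minus_right: "ip x (- y) = - ip x y"
  using ip_add_right[of x y "- y"] by (simp add: add_eq_0_iff)

lemma ip_diff_left: "ip (x - y) z = ip x z - ip y z"
  using ip_add_left[of x "- y" z] by (simp add: ip_minus_left)

lemma ip_diff_right: "ip x (y - z) = ip x y - ip x z"
  using ip_add_right[of x y "- z"] by (simp add: ip_minus_right)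

lemma ip_commute_0: "ip x y = 0 \<longleftrightarrow> ip y x = 0"
  using ip_commute[of x y] ip_commute[of y x] by auto

lemma ip_self_eq_0_iff [simp]: "ip x x = 0 \<longleftrightarrow> x = 0"
  by (simp add: ip_self del: of_real_power)

lemma ip_eq_imp_eq:
  assumes "\<And>x. ip x y = ip x z"
  shows "y = z"
proof -
  have "ip (y - z) (y - z) = 0" using assms by (simp add: ip_diff_right)
  then show ?thesis by simp
qed

text \<open>
  Pythagoras for the component of \<open>z\<close> along \<open>m\<close>. That the left-hand side is nonnegative is the
  Cauchy-Schwarz inequality; that it cannot drop below the square of a minimal distance is the
  orthogonality of nearest points.
\<close>

lemma norm_diff_component:
  assumes "m \<noteq> 0"
  shows "(norm (z - scale (ip z m / ip m m) m))\<^sup>2 = (norm z)\<^sup>2 - (norm (ip z m))\<^sup>2 / (norm m)\<^sup>2"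
proof -
  let ?n = "of_real ((norm m)\<^sup>2) :: 'k"
  let ?a = "ip z m"
  have n: "?n \<noteq> 0" using assms by simp
  have cn: "scalar_cnj (?a / ?n) = scalar_cnj ?a / ?n"
    using scalar_cnj_mult[of ?a "of_real (inverse ((norm m)\<^sup>2))"]
    by (simp only: scalar_cnj_of_real divide_inverse flip: of_real_inverse)
  have "of_real ((norm (z - scale (?a / ?n) m))\<^sup>2) = ip (z - scale (?a / ?n) m) (z - scale (?a / ?n) m)"
    by (rule ip_self[symmetric])
  also have "\<dots> = ip z z - scalar_cnj ?a / ?n * ?a - ?a / ?n * scalar_cnj ?a
      + ?a / ?n * (scalar_cnj ?a / ?n) * ?n"
    by (simp only: ip_diff_left ip_diff_right ip_scale_left ip_scale_right cn ip_self[of m]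
        ip_commute[of m z]) (simp only: algebra_simps)
  also have "\<dots> = ip z z - ?a * scalar_cnj ?a / ?n"
  proof -
    have "c - b / n * a - a / n * b + a / n * (b / n) * n = c - a * b / n" if "n \<noteq> 0" for a b c n :: 'k
      using that by (simp add: field_simps)
    then show ?thesis using n .
  qed
  also have "\<dots> = of_real ((norm z)\<^sup>2 - (norm ?a)\<^sup>2 / (norm m)\<^sup>2)"
    by (simp only: ip_self mult_scalar_cnj of_real_diff of_real_divide)
  finally show ?thesis by (simp only: of_real_eq_iff ip_self)
qed

lemma Cauchy_Schwarz: "norm (ip x y) \<le> norm x * norm y"
proof (cases "y = 0")
  case False
  have "0 \<le> (norm x)\<^sup>2 - (norm (ip x y))\<^sup>2 / (norm y)\<^sup>2"
    using norm_diff_component[OF False, of x] by (metis zero_le_power2)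
  then have "(norm (ip x y))\<^sup>2 \<le> (norm x * norm y)\<^sup>2"
    using False by (simp add: field_simps power_mult_distrib)
  then show ?thesis by (rule power2_le_imp_le) simp
qed simp

lemma ip_scaleR_left: "ip (r *\<^sub>R x) y = r *\<^sub>R ip x y"
  using ip_scale_left[of "of_real r" x y] by (simp add: scale_of_real scaleR_conv_of_real)

lemma bounded_linear_ip_left: "bounded_linear (\<lambda>x. ip x y)"
  by (rule bounded_linear_intro[where K = "norm y"])
    (auto simp: ip_add_left ip_scaleR_left Cauchy_Schwarz)

lemma subspace_imp_real_subspace: "subspace M \<Longrightarrow> Real_Vector_Spaces.subspace M"
  unfolding Real_Vector_Spaces.subspace_def scale_of_real[symmetric]
  by (auto intro: subspace_0 subspace_add subspace_scale)

lemma subspace_orthogonal_complement: "subspace (orthogonal_complement ip M)"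
  by (rule subspaceI) (auto simp: orthogonal_complement_def ip_add_left ip_scale_left)

lemma closed_orthogonal_complement: "closed (orthogonal_complement ip M)"
proof -
  have "closed {x. ip x y = 0}" for y
    using bounded_linear_ip_left[of y] by (intro closed_Collect_eq linear_continuous_on continuous_intros)
  then have "closed (\<Inter>y\<in>M. {x. ip x y = 0})" by blast
  moreover have "orthogonal_complement ip M = (\<Inter>y\<in>M. {x. ip x y = 0})"
    by (auto simp: orthogonal_complement_def)
  ultimately show ?thesis by simp
qed

lemma parallelogram_law:
  "(norm (x + y))\<^sup>2 + (norm (x - y))\<^sup>2 = 2 * (norm x)\<^sup>2 + 2 * (norm y)\<^sup>2"
  for x y :: 'a
proof -
  have "ip (x + y) (x + y) + ip (x - y) (x - y) = 2 * ip x x + 2 * ip y y"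
    by (simp add: ip_add_left ip_add_right ip_diff_left ip_diff_right)
  then have "of_real ((norm (x + y))\<^sup>2 + (norm (x - y))\<^sup>2) =
      (of_real (2 * (norm x)\<^sup>2 + 2 * (norm y)\<^sup>2) :: 'k)"
    by (simp only: ip_self of_real_add of_real_mult of_real_numeral)
  then show ?thesis by (simp only: of_real_eq_iff)
qed

text \<open>
  By the parallelogram law, points of \<open>M\<close> that nearly minimise the distance to \<open>x\<close> are close to each
  other, as their midpoint lies in \<open>M\<close>; so a minimising sequence converges.
\<close>

lemma nearest_point_exists:
  assumes M: "closed M" "subspace M"
  obtains p where "p \<in> M" "\<And>y. y \<in> M \<Longrightarrow> norm (x - p) \<le> norm (x - y)"
proof -
  let ?D = "(\<lambda>y. (norm (x - y))\<^sup>2) ` M"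
  define d where "d = Inf ?D"
  have ne: "?D \<noteq> {}" using subspace_0[OF M(2)] by blast
  have bdd: "bdd_below ?D" by (rule bdd_belowI[of _ 0]) auto
  have d_le: "d \<le> (norm (x - y))\<^sup>2" if "y \<in> M" for y
    unfolding d_def using bdd that by (intro cInf_lower) auto
  have "\<exists>y\<in>M. (norm (x - y))\<^sup>2 < d + inverse (real (Suc n))" for n
    using cInf_lessD[OF ne, of "d + inverse (real (Suc n))"] by (auto simp: d_def)
  then obtain y where y: "\<And>n. y n \<in> M" "\<And>n. (norm (x - y n))\<^sup>2 < d + inverse (real (Suc n))"
    by metis
  have near: "(norm (y m - y n))\<^sup>2 \<le> 2 * inverse (real (Suc m)) + 2 * inverse (real (Suc n))" for m n
  proof -
    \<comment> \<open>The midpoint lies in \<open>M\<close>, so its distance to \<open>x\<close> is at least the infimum.\<close>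
    let ?h = "scale (of_real (1/2)) (y m + y n)"
    have h: "?h \<in> M" using y(1) M(2) by (intro subspace_scale subspace_add)
    have "(x - y m) + (x - y n) = 2 *\<^sub>R (x - ?h)"
      by (simp add: scale_of_real algebra_simps scaleR_2 del: of_real_divide)
    then have "(norm ((x - y m) + (x - y n)))\<^sup>2 = 4 * (norm (x - ?h))\<^sup>2"
      by (simp add: power_mult_distrib)
    moreover have "norm ((x - y m) - (x - y n)) = norm (y m - y n)"
      by (simp add: norm_minus_commute)
    ultimately have "4 * (norm (x - ?h))\<^sup>2 + (norm (y m - y n))\<^sup>2 =
        2 * (norm (x - y m))\<^sup>2 + 2 * (norm (x - y n))\<^sup>2"
      using parallelogram_law[of "x - y m" "x - y n"] by simp
    then show ?thesis using d_le[OF h] y(2)[of m] y(2)[of n] by linarith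
  qed
  have "Cauchy y"
  proof (rule metric_CauchyI)
    fix e :: real assume e: "0 < e"
    then obtain N where N: "inverse (real (Suc N)) < e\<^sup>2 / 4"
      using reals_Archimedean[of "e\<^sup>2 / 4"] by auto
    have "dist (y m) (y n) < e" if "m \<ge> N" "n \<ge> N" for m n
    proof -
      have "inverse (real (Suc m)) \<le> inverse (real (Suc N))"
          "inverse (real (Suc n)) \<le> inverse (real (Suc N))"
        using that by (auto intro: le_imp_inverse_le)
      then have "(norm (y m - y n))\<^sup>2 < e\<^sup>2" using near[of m n] N by linarith
      then have "norm (y m - y n) < e" by (rule power2_less_imp_less) (use e in simp)
      then show ?thesis by (simp add: dist_norm)
    qed
    then show "\<exists>N. \<forall>m\<ge>N. \<forall>n\<ge>N. dist (y m) (y n) < e" by blast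
  qed
  then obtain p where p: "y \<longlonglongrightarrow> p" using Cauchy_convergent by (auto simp: convergent_def)
  have "(\<lambda>n. (norm (x - y n))\<^sup>2) \<longlonglongrightarrow> (norm (x - p))\<^sup>2"
    using p by (intro tendsto_intros)
  moreover have "(\<lambda>n. d + inverse (real (Suc n))) \<longlonglongrightarrow> d + 0"
    using LIMSEQ_inverse_real_of_nat by (intro tendsto_intros)
  ultimately have "(norm (x - p))\<^sup>2 \<le> d + 0"
    using y(2) by (intro LIMSEQ_le) (auto intro: less_imp_le)
  then have "norm (x - p) \<le> norm (x - z)" if "z \<in> M" for z
    using d_le[OF that] by (auto intro: power2_le_imp_le[OF order_trans])
  moreover have "p \<in> M" using closed_sequentially[OF M(1) _ p] y(1) by blast
  ultimately show thesis using that by blast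
qed

lemma orthogonal_decomposition:
  assumes M: "closed M" "subspace M"
  obtains p where "p \<in> M" "x - p \<in> orthogonal_complement ip M"
proof -
  obtain p where p: "p \<in> M" "\<And>y. y \<in> M \<Longrightarrow> norm (x - p) \<le> norm (x - y)"
    using nearest_point_exists[OF M, where x = x] by metis
  have "ip (x - p) m = 0" if m: "m \<in> M" for m
  proof (cases "m = 0")
    case False
    let ?t = "ip (x - p) m / ip m m"
    have "norm (x - p) \<le> norm (x - (p + scale ?t m))"
      using p(1) m M(2) by (intro p(2) subspace_add subspace_scale)
    then have "(norm (x - p))\<^sup>2 \<le> (norm (x - p - scale ?t m))\<^sup>2"
      by (intro power_mono) (simp_all add: algebra_simps)
    then have "(norm (ip (x - p) m))\<^sup>2 / (norm m)\<^sup>2 \<le> 0"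
      unfolding norm_diff_component[OF False] by simp
    then show ?thesis using False by (simp add: divide_le_0_iff)
  qed simp
  then show thesis using p(1) that by (auto simp: orthogonal_complement_def)
qed

lemma orthogonal_complement_Int:
  "x \<in> M \<Longrightarrow> x \<in> orthogonal_complement ip M \<Longrightarrow> x = 0"
  using ip_self_eq_0_iff[of x] by (auto simp: orthogonal_complement_def)

lemma orthogonal_complement_twice:
  assumes M: "closed M" "subspace M"
  shows "orthogonal_complement ip (orthogonal_complement ip M) = M" (is "?C (?C M) = M")
proof
  show "M \<subseteq> ?C (?C M)" using ip_commute_0 by (auto simp: orthogonal_complement_def)
  show "?C (?C M) \<subseteq> M"
  proof
    fix x assume x: "x \<in> ?C (?C M)"
    obtain p where p: "p \<in> M" "x - p \<in> ?C M" using orthogonal_decomposition[OF M] by metis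
    have "p \<in> ?C (?C M)" using p(1) ip_commute_0 by (auto simp: orthogonal_complement_def)
    then have "x - p \<in> ?C (?C M)" using x subspace_orthogonal_complement by (simp add: subspace_diff)
    then have "x - p = 0" using p(2) orthogonal_complement_Int by blast
    then show "x \<in> M" using p(1) by simp
  qed
qed

lemma orthogonal_projection_exists:
  assumes M: "closed M" "subspace M"
  obtains P where "bounded_operator scale scale P" "\<And>x. P x \<in> M"
    "\<And>x. x - P x \<in> orthogonal_complement ip M" "\<And>x. x \<in> M \<Longrightarrow> P x = x"
proof -
  have "\<exists>p. p \<in> M \<and> x - p \<in> orthogonal_complement ip M" for x
    using orthogonal_decomposition[OF M] by metis
  then obtain P where P: "\<And>x. P x \<in> M" "\<And>x. x - P x \<in> orthogonal_complement ip M"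
    by metis
  \<comment> \<open>Linearity follows from the uniqueness of the decomposition.\<close>
  note C = subspace_orthogonal_complement[of M]
  have unique: "P x = p" if p: "p \<in> M" "x - p \<in> orthogonal_complement ip M" for x p
  proof -
    have "p - P x \<in> M" using p(1) P(1) M(2) by (simp add: subspace_diff)
    moreover have "p - P x \<in> orthogonal_complement ip M"
      using subspace_diff[OF C P(2)[of x] p(2)] by simp
    ultimately have "p - P x = 0" by (rule orthogonal_complement_Int)
    then show ?thesis by simp
  qed
  have add: "P (x + y) = P x + P y" for x y
  proof (rule unique)
    show "P x + P y \<in> M" using P(1) M(2) by (simp add: subspace_add)
    show "x + y - (P x + P y) \<in> orthogonal_complement ip M"
      using subspace_add[OF C P(2)[of x] P(2)[of y]] by (simp add: algebra_simps)
  qed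
  have scl: "P (scale c x) = scale c (P x)" for c x
  proof (rule unique)
    show "scale c (P x) \<in> M" using P(1) M(2) by (simp add: subspace_scale)
    show "scale c x - scale c (P x) \<in> orthogonal_complement ip M"
      using subspace_scale[OF C P(2)[of x], of c] by (simp add: scale_right_diff_distrib)
  qed
  have nrm: "norm (P x) \<le> norm x * 1" for x
  proof -
    have "ip (x - P x) (P x) = 0" using P by (auto simp: orthogonal_complement_def)
    then have "ip x (P x) = ip (P x) (P x)" by (simp add: ip_diff_left)
    then have "norm (ip x (P x)) = (norm (P x))\<^sup>2" by (simp add: ip_self norm_power)
    then have "norm (P x) * norm (P x) \<le> norm x * norm (P x)"
      using Cauchy_Schwarz[of x "P x"] by (simp add: power2_eq_square)
    then show ?thesis by (cases "P x = 0") auto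
  qed
  have "bounded_operator scale scale P"
    unfolding bounded_operator_def
  proof
    show "Vector_Spaces.linear scale scale P"
      by unfold_locales (simp_all add: add scl)
    show "bounded_linear P"
      using add scl[of "of_real _"] nrm
      by (intro bounded_linear_intro[where K = 1]) (simp_all add: scale_of_real)
  qed
  moreover have "P x = x" if "x \<in> M" for x
    using that by (intro unique) (auto simp: orthogonal_complement_def)
  ultimately show thesis using P that by blast
qed

text \<open>
  The orthogonal complement of the null space of a nonzero functional contains a vector \<open>u\<close> on which
  the functional does not vanish, and every \<open>x\<close> differs from a multiple of \<open>u\<close> by an element of the
  null space.
\<close>

lemma Riesz_representation:
  assumes f: "bounded_linear f" "\<And>c x. f (scale c x) = c * f x"
  obtains w where "\<And>x. f x = ip x w"
proof (cases "\<forall>x. f x = 0")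
  case True
  then show thesis using that[of 0] by simp
next
  case False
  then obtain z where z: "f z \<noteq> 0" by blast
  interpret f: bounded_linear f by (fact f(1))
  let ?N = "{x. f x = 0}"
  have "closed ?N"
    using f(1) by (intro closed_Collect_eq linear_continuous_on continuous_intros)
  moreover have "subspace ?N"
    by (rule subspaceI) (auto simp: f.add f.zero f(2))
  ultimately obtain p where p: "f p = 0" "z - p \<in> orthogonal_complement ip ?N"
    using orthogonal_decomposition[of ?N z] by blast
  define u where "u = z - p"
  have fu: "f u \<noteq> 0" using z p(1) by (simp add: u_def f.diff)
  have u0: "ip u u \<noteq> 0" using fu f.zero by auto
  show thesis
  proof
    fix x
    have "f (x - scale (f x / f u) u) = 0" using fu by (simp add: f.diff f(2))
    then have "ip u (x - scale (f x / f u) u) = 0"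
      using p(2) by (simp add: u_def orthogonal_complement_def)
    then have "ip (x - scale (f x / f u) u) u = 0" by (simp add: ip_commute_0)
    then have "ip x u = f x / f u * ip u u" by (simp add: ip_diff_left ip_scale_left)
    then show "f x = ip x (scale (scalar_cnj (f u / ip u u)) u)"
      using fu u0 by (simp add: ip_scale_right)
  qed
qed

text \<open>
  By Baire's theorem, one of the closed sets of vectors \<open>v\<close> on which all functionals \<open>ip v x\<close> with
  \<open>x \<in> E\<close> are bounded by the same number contains a ball. Testing with the vector from the centre of
  this ball to its boundary in the direction of \<open>x\<close> bounds the norm of \<open>x\<close>.
\<close>

lemma uniform_boundedness:
  assumes "\<And>v. \<exists>C. \<forall>x\<in>E. norm (ip v x) \<le> C"
  obtains C where "\<And>x. x \<in> E \<Longrightarrow> norm x \<le> C"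
proof -
  define F where "F = (\<lambda>n::nat. {v. \<forall>x\<in>E. norm (ip v x) \<le> real n})"
  have "closed {v. norm (ip v x) \<le> real n}" for x n
    using bounded_linear_ip_left[of x]
    by (intro closed_Collect_le linear_continuous_on continuous_intros)
  then have "closed (\<Inter>x\<in>E. {v. norm (ip v x) \<le> real n})" for n by blast
  moreover have "F n = (\<Inter>x\<in>E. {v. norm (ip v x) \<le> real n})" for n by (auto simp: F_def)
  ultimately have closed_F: "closed (F n)" for n by simp
  have cover: "\<Union>(range F) = UNIV"
  proof -
    have "v \<in> \<Union>(range F)" for v
    proof -
      obtain C where C: "\<forall>x\<in>E. norm (ip v x) \<le> C" using assms by blast
      obtain n where "C \<le> real n" using real_arch_simple by blast
      then have "v \<in> F n" using C by (force simp: F_def)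
      then show ?thesis by blast
    qed
    then show ?thesis by blast
  qed
  have "\<exists>n. interior (F n) \<noteq> {}"
  proof (rule ccontr)
    assume "\<not> ?thesis"
    then have "Met_TC.mtopology interior_of \<Union>(range F) = {}"
      using closed_F by (intro Met_TC.metric_Baire_category_alt) (auto simp: complete_UNIV)
    then show False unfolding cover by simp
  qed
  then obtain n v where "v \<in> interior (F n)" by blast
  then obtain r where r: "r > 0" "cball v r \<subseteq> F n" unfolding mem_interior_cball by blast
  have "norm x \<le> 2 * real n / r" if x: "x \<in> E" for x
  proof (cases "x = 0")
    case False
    let ?y = "(r / norm x) *\<^sub>R x"
    have "v + ?y \<in> cball v r" "v \<in> cball v r" using r(1) False by (auto simp: dist_norm)
    then have "v + ?y \<in> F n" "v \<in> F n" using r(2) by blast+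
    then have b: "norm (ip (v + ?y) x) \<le> real n" "norm (ip v x) \<le> real n" using x by (auto simp: F_def)
    have "norm (ip ?y x) = r * norm x"
      using False r(1) by (simp add: ip_scaleR_left ip_self norm_mult power2_eq_square)
    moreover have "ip ?y x = ip (v + ?y) x - ip v x" by (simp add: ip_add_left)
    ultimately have "r * norm x \<le> 2 * real n"
      using norm_triangle_ineq4[of "ip (v + ?y) x" "ip v x"] b by simp
    then show ?thesis using r(1) by (simp add: field_simps)
  qed (use r(1) in simp)
  then show thesis using that by blast
qed

end

section \<open>Closed subspaces\<close>

context hilbert_space
begin

lemma norm_scale: "norm (scale c x) = norm c * norm x"
proof -
  have "of_real ((norm (scale c x))\<^sup>2) = c * scalar_cnj c * ip x x"
    unfolding ip_self[symmetric] by (simp add: ip_scale_left ip_scale_right)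
  also have "\<dots> = of_real ((norm c)\<^sup>2 * (norm x)\<^sup>2)"
    by (simp only: mult_scalar_cnj ip_self of_real_mult)
  finally have "(norm (scale c x))\<^sup>2 = (norm c * norm x)\<^sup>2"
    by (simp only: of_real_eq_iff power_mult_distrib)
  then show ?thesis by simp
qed

lemma bounded_linear_scale_left: "bounded_linear (\<lambda>c. scale c x)"
proof (rule bounded_linear_intro[where K = "norm x"])
  show "scale (r *\<^sub>R c) x = r *\<^sub>R scale c x" for r c
    by (simp add: scaleR_conv_of_real flip: scale_of_real)
qed (simp_all add: scale_left_distrib norm_scale)

text \<open>
  The new vector can be replaced by its component \<open>w\<close> orthogonal to \<open>Z\<close>. Then the coefficient of \<open>w\<close>
  in an element of the span is a continuous function of that element.
\<close>

lemma closed_span_insert: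
  assumes Z: "closed Z" "subspace Z"
  shows "closed (span (insert v Z))"
proof -
  obtain p where p: "p \<in> Z" "v - p \<in> orthogonal_complement ip Z"
    using orthogonal_decomposition[OF Z, of v] .
  define w where "w = v - p"
  have v: "v = w + p" by (simp add: w_def)
  have w: "ip y w = 0" if "y \<in> Z" for y
    using p(2) that ip_commute_0 by (auto simp: orthogonal_complement_def w_def)
  have Zspan: "span Z = Z" using Z(2) by simp
  show ?thesis
  proof (cases "w = 0")
    case True
    then have "insert v Z = Z" using v p(1) by auto
    then show ?thesis using Z(1) by (simp only: Zspan)
  next
    case False
    let ?g = "\<lambda>y. y - scale (ip y w / ip w w) w"
    have "y - scale k v \<in> Z \<longleftrightarrow> y - scale k w \<in> Z" for y k
    proof -
      have "scale k p \<in> Z" using p(1) Z(2) by (rule_tac subspace_scale)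
      moreover have "y - scale k w = (y - scale k v) + scale k p"
        by (simp add: v scale_right_distrib)
      ultimately show ?thesis using Z(2)
        by (metis add_diff_cancel_right' subspace_add subspace_diff)
    qed
    moreover have "k = ip y w / ip w w" if "y - scale k w \<in> Z" for y k
      using w[OF that] False by (simp add: ip_diff_left ip_scale_left)
    ultimately have "span (insert v Z) = ?g -` Z"
      unfolding set_eq_iff span_breakdown_eq Zspan by (metis vimage_eq)
    moreover have "continuous_on UNIV ?g"
    proof -
      have "bounded_linear (\<lambda>y. scale (ip y w / ip w w) w)"
        using bounded_linear_compose[OF bounded_linear_scale_left[of w]
            bounded_linear_compose[OF bounded_linear_divide[of "ip w w"] bounded_linear_ip_left[of w]]]
        by simp
      then show ?thesis
        by (intro continuous_on_diff continuous_on_id linear_continuous_on)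
    qed
    ultimately show ?thesis using Z(1) by (simp add: closed_vimage)
  qed
qed

lemma closed_finite_over:
  assumes Z: "closed Z" "subspace Z" and V: "subspace V" "Z \<subseteq> V" "finite_over scale V Z"
  shows "closed V"
proof -
  have closed: "closed (span (Z \<union> F))" if "finite F" for F
    using that
  proof (induction F)
    case empty
    have "span Z = Z" using Z(2) by simp
    then show ?case using Z(1) by (simp only: Un_empty_right)
  next
    case (insert v F)
    have "span (Z \<union> insert v F) = span (insert v (span (Z \<union> F)))"
    proof (intro equalityI span_minimal subspace_span)
      show "Z \<union> insert v F \<subseteq> span (insert v (span (Z \<union> F)))"
        by (auto intro!: span_base)
      have "span (Z \<union> F) \<subseteq> span (Z \<union> insert v F)" by (rule span_mono) auto
      then show "insert v (span (Z \<union> F)) \<subseteq> span (Z \<union> insert v F)"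
        by (auto intro: span_base)
    qed
    then show ?case using closed_span_insert[OF insert.IH] by simp
  qed
  obtain B where B: "relative_basis scale V Z B"
    using relative_basis_exists[OF Z(2) V(3)] .
  then have "finite B" and "Z \<union> B \<subseteq> V" and "V \<subseteq> span (Z \<union> B)"
    using V(2) by (auto simp: relative_basis_def independent_modulo_def)
  then show ?thesis using closed[of B] span_subspace[OF _ _ V(1)] by metis
qed

lemma closed_finite_dimensional:
  "subspace V \<Longrightarrow> finite_over scale V {0} \<Longrightarrow> closed V"
  by (rule closed_finite_over[of "{0}"]) (auto simp: subspace_0)

lemma orthogonal_complement_span:
  "orthogonal_complement ip (span D) = orthogonal_complement ip D" (is "_ = ?C")
proof
  show "orthogonal_complement ip (span D) \<subseteq> ?C"
    by (auto simp: orthogonal_complement_def intro: span_base)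
  show "?C \<subseteq> orthogonal_complement ip (span D)"
  proof
    fix x assume "x \<in> ?C"
    then have "D \<subseteq> {y. ip x y = 0}" by (auto simp: orthogonal_complement_def)
    moreover have "subspace {y. ip x y = 0}"
      by (rule subspaceI) (auto simp: ip_add_right ip_scale_right)
    ultimately have "span D \<subseteq> {y. ip x y = 0}" by (rule span_minimal)
    then show "x \<in> orthogonal_complement ip (span D)" by (auto simp: orthogonal_complement_def)
  qed
qed

lemma finite_over_UNIV_orthogonal_complement:
  assumes "finite D"
  shows "finite_over scale UNIV (orthogonal_complement ip D)"
proof -
  have "finite_over scale (span D) {0}"
    unfolding finite_over_def using assms span_mono[of D "{0} \<union> D"] by blast
  then have closed: "closed (span D)" by (intro closed_finite_dimensional) auto
  have "x \<in> span (orthogonal_complement ip D \<union> D)" for x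
  proof -
    obtain p where "p \<in> span D" "x - p \<in> orthogonal_complement ip (span D)"
      using orthogonal_decomposition[OF closed subspace_span, of x] .
    then show ?thesis
      unfolding in_span_subspace_Un_iff[OF subspace_orthogonal_complement] orthogonal_complement_span
      by blast
  qed
  then show ?thesis using assms unfolding finite_over_def by blast
qed

lemma orthogonal_complement_antimono:
  "M \<subseteq> N \<Longrightarrow> orthogonal_complement ip N \<subseteq> orthogonal_complement ip M"
  by (auto simp: orthogonal_complement_def)

end

section \<open>Adjoints and closed ranges\<close>

text \<open>
  A relation instead of the function \<open>hilbert_adjoint\<close>, because it is symmetric in \<open>A\<close> and \<open>B\<close>; every
  fact about \<open>A\<close> and its adjoint can then be used with the roles reversed.
\<close>

definition is_adjoint ::
    "('a \<Rightarrow> 'a \<Rightarrow> 'k) \<Rightarrow> ('b \<Rightarrow> 'b \<Rightarrow> 'k) \<Rightarrow> ('a \<Rightarrow> 'b) \<Rightarrow> ('b \<Rightarrow> 'a) \<Rightarrow> bool"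
  where "is_adjoint ip1 ip2 A B \<longleftrightarrow> (\<forall>x y. ip2 (A x) y = ip1 x (B y))"

lemma closed_null_space: "bounded_linear A \<Longrightarrow> closed (null_space A)"
  unfolding null_space_def
  by (intro closed_Collect_eq linear_continuous_on continuous_intros)

lemma bounded_operator_compose:
  "bounded_operator s1 s2 A \<Longrightarrow> bounded_operator s2 s3 B \<Longrightarrow> bounded_operator s1 s3 (B \<circ> A)"
  by (auto simp: bounded_operator_def comp_def intro: bounded_linear_compose
      Vector_Spaces.linear_compose[unfolded comp_def])

locale hilbert_pair = H1: hilbert_space s1 ip1 + H2: hilbert_space s2 ip2
  for s1 :: "'k::real_or_complex_field \<Rightarrow> 'a::banach \<Rightarrow> 'a" and ip1
    and s2 :: "'k \<Rightarrow> 'b::banach \<Rightarrow> 'b" and ip2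
begin

lemma bounded_operator_add:
  assumes "bounded_operator s1 s2 A" "bounded_operator s1 s2 B"
  shows "bounded_operator s1 s2 (\<lambda>x. A x + B x)"
proof -
  interpret vector_space_pair s1 s2 ..
  show ?thesis
    using assms by (auto simp: bounded_operator_def intro: bounded_linear_add linear_compose_add)
qed

lemma is_adjoint_commute:
  assumes "is_adjoint ip1 ip2 A B"
  shows "is_adjoint ip2 ip1 B A"
  unfolding is_adjoint_def
proof (intro allI)
  fix y x
  show "ip1 (B y) x = ip2 y (A x)"
    using assms H1.ip_commute[of "B y" x] H2.ip_commute[of y "A x"]
    by (metis is_adjoint_def scalar_cnj_scalar_cnj)
qed

lemma is_adjoint_hilbert_adjoint:
  assumes A: "bounded_operator s1 s2 A"
  shows "is_adjoint ip1 ip2 A (hilbert_adjoint ip1 ip2 A)"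
proof -
  interpret A: Vector_Spaces.linear s1 s2 A using A by (simp add: bounded_operator_def)
  have "\<exists>w. \<forall>x. ip2 (A x) y = ip1 x w" for y
  proof -
    have "bounded_linear (\<lambda>x. ip2 (A x) y)"
      using A by (intro bounded_linear_compose[OF H2.bounded_linear_ip_left]) (simp add: bounded_operator_def)
    then obtain w where "\<And>x. ip2 (A x) y = ip1 x w"
      by (rule H1.Riesz_representation) (simp_all add: A.scale H2.ip_scale_left)
    then show ?thesis by blast
  qed
  then obtain B where B: "\<forall>x y. ip2 (A x) y = ip1 x (B y)" by metis
  have "hilbert_adjoint ip1 ip2 A = B"
    unfolding hilbert_adjoint_def
  proof (rule the_equality)
    fix C assume "\<forall>x y. ip2 (A x) y = ip1 x (C y)"
    then show "C = B" using B H1.ip_eq_imp_eq by (metis ext)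
  qed (fact B)
  then show ?thesis using B by (simp add: is_adjoint_def)
qed

lemma bounded_operator_adjoint:
  assumes A: "bounded_operator s1 s2 A" and AB: "is_adjoint ip1 ip2 A B"
  shows "bounded_operator s2 s1 B"
proof -
  interpret A: bounded_linear A using A by (simp add: bounded_operator_def)
  have B: "ip1 x (B y) = ip2 (A x) y" for x y using AB by (simp add: is_adjoint_def)
  have add: "B (x + y) = B x + B y" for x y
    by (rule H1.ip_eq_imp_eq) (simp add: B H1.ip_add_right H2.ip_add_right)
  have scl: "B (s2 c x) = s1 c (B x)" for c x
    by (rule H1.ip_eq_imp_eq) (simp add: B H1.ip_scale_right H2.ip_scale_right)
  obtain K where K: "0 \<le> K" "\<And>x. norm (A x) \<le> norm x * K" using A.nonneg_bounded by blast
  have nrm: "norm (B y) \<le> norm y * K" for y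
  proof -
    have "(norm (B y))\<^sup>2 = norm (ip2 (A (B y)) y)"
      unfolding B[symmetric] by (simp add: H1.ip_self norm_power)
    also have "\<dots> \<le> norm (A (B y)) * norm y" by (rule H2.Cauchy_Schwarz)
    also have "\<dots> \<le> norm (B y) * K * norm y" using K by (intro mult_right_mono) auto
    finally have "norm (B y) * norm (B y) \<le> norm (B y) * (norm y * K)"
      by (simp add: power2_eq_square algebra_simps)
    moreover have "0 \<le> norm y * K" using K(1) by simp
    ultimately show ?thesis by (cases "B y = 0") auto
  qed
  show ?thesis
    unfolding bounded_operator_def
  proof
    show "Vector_Spaces.linear s2 s1 B" by unfold_locales (simp_all add: add scl)
    show "bounded_linear B"
      using add scl[of "of_real _"] nrm
      by (intro bounded_linear_intro[where K = K]) (simp_all add: H1.scale_of_real H2.scale_of_real)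
  qed
qed

lemma null_space_adjoint:
  assumes AB: "is_adjoint ip1 ip2 A B"
  shows "null_space B = orthogonal_complement ip2 (range A)"
proof -
  have "B y = 0 \<longleftrightarrow> (\<forall>x. ip2 y (A x) = 0)" for y
  proof
    assume "\<forall>x. ip2 y (A x) = 0"
    then have "ip1 x (B y) = ip1 x 0" for x
      using AB H2.ip_commute_0[of y "A x"] by (simp add: is_adjoint_def)
    then show "B y = 0" by (rule H1.ip_eq_imp_eq)
  next
    assume "B y = 0"
    then show "\<forall>x. ip2 y (A x) = 0"
      using AB H2.ip_commute_0[of y] by (simp add: is_adjoint_def)
  qed
  then show ?thesis by (auto simp: null_space_def orthogonal_complement_def)
qed

text \<open>
  On the vectors \<open>x \<in> M\<close> orthogonal to a finite set \<open>D\<close> whose span together with \<open>R(A)\<close> covers \<open>M\<close>, the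
  operator \<open>B\<close> is bounded below: every functional \<open>ip2 v\<close> agrees there with \<open>ip1 u \<circ> B\<close> for some \<open>u\<close>, so
  the set of those \<open>x\<close> with \<open>norm (B x) \<le> 1\<close> is weakly bounded and hence bounded. So \<open>B\<close> maps this
  closed subspace onto a closed one. The whole range of \<open>B\<close> is only finitely many dimensions larger,
  since \<open>B\<close> vanishes on the orthogonal complement of \<open>M\<close>.
\<close>

lemma closed_range_adjoint:
  assumes A: "bounded_operator s1 s2 A" and AB: "is_adjoint ip1 ip2 A B"
    and M: "closed M" "H2.subspace M" "range A \<subseteq> M" "finite_over s2 M (range A)"
  shows "closed (range B)"
proof -
  have Bop: "bounded_operator s2 s1 B" using bounded_operator_adjoint[OF A AB] .
  interpret A: Vector_Spaces.linear s1 s2 A using A by (simp add: bounded_operator_def)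
  interpret B: Vector_Spaces.linear s2 s1 B using Bop by (simp add: bounded_operator_def)
  interpret Bb: bounded_linear B using Bop by (simp add: bounded_operator_def)
  obtain D where D: "finite D" "M \<subseteq> H2.span (range A \<union> D)"
    using M(4) by (auto simp: finite_over_def)
  define X where "X = M \<inter> orthogonal_complement ip2 D"
  have X: "closed X" "H2.subspace X" "X \<subseteq> M"
    unfolding X_def using M H2.closed_orthogonal_complement H2.subspace_orthogonal_complement
    by (auto intro: H2.subspace_inter)
  have weak: "\<exists>u. \<forall>x\<in>X. ip2 v x = ip1 u (B x)" for v
  proof -
    obtain m where m: "m \<in> M" "v - m \<in> orthogonal_complement ip2 M"
      using H2.orthogonal_decomposition[OF M(1,2), of v] .
    then obtain d where d: "d \<in> H2.span D" "m - d \<in> range A"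
      using D(2) H2.in_span_subspace_Un_iff[OF A.subspace_range] by blast
    then obtain u where u: "m - d = A u" by blast
    have "ip2 v x = ip1 u (B x)" if x: "x \<in> X" for x
    proof -
      have "x \<in> orthogonal_complement ip2 (H2.span D)"
        using x by (simp add: X_def H2.orthogonal_complement_span)
      then have "ip2 d x = 0" using d(1) H2.ip_commute_0[of d x] by (simp add: orthogonal_complement_def)
      moreover have "ip2 (v - m) x = 0" using m(2) x X(3) by (auto simp: orthogonal_complement_def)
      moreover have "v = (v - m) + (A u + d)" by (simp flip: u)
      ultimately have "ip2 v x = ip2 (A u) x" by (metis H2.ip_add_left add.right_neutral add_0)
      then show ?thesis using AB by (simp add: is_adjoint_def)
    qed
    then show ?thesis by blast
  qed
  have "\<exists>C. \<forall>x\<in>{x\<in>X. norm (B x) \<le> 1}. norm (ip2 v x) \<le> C" for v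
  proof -
    obtain u where u: "\<forall>x\<in>X. ip2 v x = ip1 u (B x)" using weak by blast
    have "norm (ip2 v x) \<le> norm u" if "x \<in> X" "norm (B x) \<le> 1" for x
    proof -
      have "norm (ip2 v x) \<le> norm u * norm (B x)" using u that(1) H1.Cauchy_Schwarz by simp
      also have "\<dots> \<le> norm u * 1" using that(2) by (intro mult_left_mono) auto
      finally show ?thesis by simp
    qed
    then show ?thesis by blast
  qed
  then obtain C where C: "\<And>x. x \<in> {x\<in>X. norm (B x) \<le> 1} \<Longrightarrow> norm x \<le> C"
    by (rule H2.uniform_boundedness) blast
  define K where "K = max C 1"
  have K: "K > 0" "\<And>x. x \<in> X \<Longrightarrow> norm (B x) \<le> 1 \<Longrightarrow> norm x \<le> K"
    using C by (auto simp: K_def le_max_iff_disj)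
  have below: "norm x \<le> K * norm (B x)" if x: "x \<in> X" for x
  proof -
    have Xs: "r *\<^sub>R x \<in> X" for r
      using x X(2) H2.subspace_imp_real_subspace by (metis Real_Vector_Spaces.subspace_scale)
    \<comment> \<open>The additional \<open>e\<close> allows scaling \<open>x\<close> to an element with image in the unit ball even if \<open>B x = 0\<close>.\<close>
    have "norm x \<le> K * norm (B x) + e" if e: "e > 0" for e
    proof -
      let ?s = "norm (B x) + e / K"
      have s: "?s > 0" using e K(1) by (simp add: add_nonneg_pos)
      have "norm (B (inverse ?s *\<^sub>R x)) \<le> 1"
        using s e K(1) by (simp add: Bb.scaleR field_simps)
      then have "norm (inverse ?s *\<^sub>R x) \<le> K" using Xs K(2) by blast
      then have "norm x \<le> K * ?s" using s by (simp add: field_simps)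
      also have "\<dots> = K * norm (B x) + e" using K(1) by (simp add: field_simps)
      finally show ?thesis .
    qed
    then show ?thesis by (rule field_le_epsilon)
  qed
  have "complete (B ` X)"
  proof (rule complete_isometric_image)
    show "0 < inverse K" using K(1) by simp
    show "Real_Vector_Spaces.subspace X" using H2.subspace_imp_real_subspace[OF X(2)] .
    show "bounded_linear B" by (rule Bb.bounded_linear_axioms)
    show "\<forall>x\<in>X. inverse K * norm x \<le> norm (B x)"
      using below K(1) by (simp add: field_simps)
    show "complete X" using X(1) by (simp add: complete_eq_closed)
  qed
  then have closedX: "closed (B ` X)" by (rule complete_imp_closed)
  have "finite_over s2 M (orthogonal_complement ip2 D)"
    using H2.finite_over_mono[OF H2.finite_over_UNIV_orthogonal_complement[OF D(1)]] by blast
  then have "finite_over s2 M X"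
    unfolding X_def by (rule H2.finite_over_Int[OF M(2) H2.subspace_orthogonal_complement])
  then have "finite_over s1 (B ` M) (B ` X)" by (rule B.finite_over_image)
  moreover have "range B = B ` M"
  proof -
    have "B y \<in> B ` M" for y
    proof -
      obtain m where m: "m \<in> M" "y - m \<in> orthogonal_complement ip2 M"
        using H2.orthogonal_decomposition[OF M(1,2), of y] .
      then have "y - m \<in> null_space B"
        using null_space_adjoint[OF AB] H2.orthogonal_complement_antimono[OF M(3)] by blast
      then have "B y = B m" by (simp add: null_space_def B.diff)
      then show ?thesis using m(1) by blast
    qed
    then show ?thesis by blast
  qed
  ultimately have "finite_over s1 (range B) (B ` X)" by simp
  then show ?thesis
    using H1.closed_finite_over[OF closedX B.subspace_image[OF X(2)] B.subspace_range] by blast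
qed

end

lemma hilbert_pair_commute: "hilbert_pair s1 ip1 s2 ip2 \<Longrightarrow> hilbert_pair s2 ip2 s1 ip1"
  by (simp add: hilbert_pair_def)

context hilbert_pair
begin

text \<open>
  This is the case \<open>M = R(A)\<close>.
\<close>

lemma closed_range_imp_closed_range_adjoint:
  assumes "bounded_operator s1 s2 A" "is_adjoint ip1 ip2 A B" "closed (range A)"
  shows "closed (range B)"
proof -
  interpret A: Vector_Spaces.linear s1 s2 A using assms(1) by (simp add: bounded_operator_def)
  show ?thesis
    using closed_range_adjoint[OF assms A.subspace_range order_refl] H2.finite_over_subset by blast
qed

lemma closed_range_iff_closed_range_adjoint:
  assumes A: "bounded_operator s1 s2 A" and AB: "is_adjoint ip1 ip2 A B"
  shows "closed (range A) \<longleftrightarrow> closed (range B)"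
proof -
  interpret swap: hilbert_pair s2 ip2 s1 ip1
    by (rule hilbert_pair_commute) (rule hilbert_pair_axioms)
  show ?thesis
    using closed_range_imp_closed_range_adjoint[OF A AB]
      swap.closed_range_imp_closed_range_adjoint[OF bounded_operator_adjoint[OF A AB] is_adjoint_commute[OF AB]]
    by blast
qed

text \<open>
  The case where \<open>M\<close> is the whole space shows that the adjoint has closed range, and closedness then
  passes back to \<open>A\<close>.
\<close>

lemma closed_range_of_finite_codim:
  assumes A: "bounded_operator s1 s2 A" and fin: "finite_over s2 UNIV (range A)"
  shows "closed (range A)"
proof -
  have adj: "is_adjoint ip1 ip2 A (hilbert_adjoint ip1 ip2 A)"
    by (rule is_adjoint_hilbert_adjoint[OF A])
  have "closed (range (hilbert_adjoint ip1 ip2 A))"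
    using closed_range_adjoint[OF A adj closed_UNIV H2.subspace_UNIV _ fin] by simp
  then show ?thesis using closed_range_iff_closed_range_adjoint[OF A adj] by simp
qed

lemma closed_range_eq_orthogonal_complement:
  assumes A: "bounded_operator s1 s2 A" and AB: "is_adjoint ip1 ip2 A B" and cl: "closed (range A)"
  shows "range A = orthogonal_complement ip2 (null_space B)"
proof -
  interpret A: Vector_Spaces.linear s1 s2 A using A by (simp add: bounded_operator_def)
  show ?thesis
    unfolding null_space_adjoint[OF AB]
    using H2.orthogonal_complement_twice[OF cl A.subspace_range] by simp
qed

end

section \<open>The indices as relative dimensions\<close>

lemma fredholm_operator_iff:
  assumes A: "bounded_operator s1 s2 A"
  shows "fredholm_operator s1 s2 A \<longleftrightarrow>
    commensurable s1 (null_space A) {0} \<and> commensurable s2 (range A) UNIV"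
proof -
  interpret A: Vector_Spaces.linear s1 s2 A using A by (simp add: bounded_operator_def)
  have "{0} \<subseteq> null_space A" by (simp add: null_space_def)
  then have "finite_over s1 {0} (null_space A)" by (rule A.vs1.finite_over_subset)
  moreover have "finite_over s2 (range A) UNIV" by (rule A.vs2.finite_over_subset) simp
  moreover have "fin_dim_quotient s2 UNIV (range A) \<longleftrightarrow> finite_over s2 UNIV (range A)"
    by (intro A.vs2.fin_dim_quotient_iff A.subspace_range) auto
  ultimately show ?thesis
    using A A.vs1.fin_dim_iff_finite_over_0[OF A.subspace_null_space]
    by (auto simp: fredholm_operator_def commensurable_def)
qed

lemma operator_index_eq:
  assumes A: "fredholm_operator s1 s2 A"
  shows "operator_index s1 s2 A = relative_dim s1 (null_space A) {0} + relative_dim s2 (range A) UNIV"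
proof -
  have A': "bounded_operator s1 s2 A" using A by (simp add: fredholm_operator_def)
  interpret A: Vector_Spaces.linear s1 s2 A using A' by (simp add: bounded_operator_def)
  have "finite_over s1 (null_space A) {0}"
    using A by (simp add: fredholm_operator_iff[OF A'] commensurable_def)
  then have "A.vs1.dim (null_space A) = dim_quotient s1 (null_space A) {0}"
    by (rule A.vs1.dim_eq_dim_quotient_0[OF A.subspace_null_space])
  moreover have "null_space A \<inter> {0} = {0}" by (auto simp: null_space_def)
  moreover have "dim_quotient s1 {0} {0} = 0" by (simp add: A.vs1.dim_quotient_self)
  moreover have "dim_quotient s2 (range A) (range A) = 0"
    by (rule A.vs2.dim_quotient_self[OF A.subspace_range])
  ultimately show ?thesis by (simp add: operator_index_def relative_dim_def)
qed

lemma fredholm_pair_iff: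
  assumes S: "bounded_operator s1 s2 S" and T: "bounded_operator s2 s1 T"
  shows "fredholm_pair s1 s2 S T \<longleftrightarrow>
    commensurable s1 (null_space S) (range T) \<and> commensurable s2 (range S) (null_space T)"
proof -
  interpret S: Vector_Spaces.linear s1 s2 S using S by (simp add: bounded_operator_def)
  interpret T: Vector_Spaces.linear s2 s1 T using T by (simp add: bounded_operator_def)
  show ?thesis
    using S T
      S.vs1.fin_dim_quotient_Int_iff[OF S.subspace_null_space T.subspace_range]
      S.vs1.fin_dim_quotient_Int_iff[OF T.subspace_range S.subspace_null_space]
      S.vs2.fin_dim_quotient_Int_iff[OF T.subspace_null_space S.subspace_range]
      S.vs2.fin_dim_quotient_Int_iff[OF S.subspace_range T.subspace_null_space]
    by (auto simp: fredholm_pair_def commensurable_def Int_commute)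
qed

lemma pair_index_eq:
  "pair_index s1 s2 S T =
    relative_dim s1 (null_space S) (range T) + relative_dim s2 (range S) (null_space T)"
  by (simp add: pair_index_def relative_dim_def Int_commute)

lemma pair_index_commute: "pair_index s2 s1 T S = - pair_index s1 s2 S T"
  by (simp add: pair_index_def Int_commute)

lemma fredholm_pair_commute: "fredholm_pair s2 s1 T S \<longleftrightarrow> fredholm_pair s1 s2 S T"
  by (auto simp: fredholm_pair_def Int_commute)

section \<open>Fredholm pairs with vanishing products\<close>

context hilbert_pair
begin

text \<open>
  The condition \<open>T S = 0\<close> makes \<open>R(S)\<close> and \<open>R(T')\<close> orthogonal, so \<open>A\<close> splits into \<open>S\<close> and \<open>T'\<close>. Each of
  the two Fredholm conditions forces \<open>R(T')\<close>, and with it \<open>R(T)\<close>, to be closed. Then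
  \<open>N(S) = R(T) + N(A)\<close> and \<open>N(T) + R(A)\<close> is the whole space, with \<open>R(T) \<inter> N(A) = 0\<close> and
  \<open>N(T) \<inter> R(A) = R(S)\<close>, so that the quotients for the pair and for the operator are isomorphic.
\<close>

lemma fredholm_pair_exact:
  assumes S: "bounded_operator s1 s2 S" and T: "bounded_operator s2 s1 T"
    and TT': "is_adjoint ip2 ip1 T T'"
    and TS: "\<And>x. T (S x) = 0" and ST: "\<And>y. S (T y) = 0"
  defines "A \<equiv> \<lambda>x. S x + T' x"
  shows "fredholm_pair s1 s2 S T \<longleftrightarrow> fredholm_operator s1 s2 A"
    and "fredholm_pair s1 s2 S T \<Longrightarrow> pair_index s1 s2 S T = operator_index s1 s2 A"
proof -
  interpret swap: hilbert_pair s2 ip2 s1 ip1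
    by (rule hilbert_pair_commute) (rule hilbert_pair_axioms)
  have T': "bounded_operator s1 s2 T'" using swap.bounded_operator_adjoint[OF T TT'] .
  have A: "bounded_operator s1 s2 A" unfolding A_def by (rule bounded_operator_add[OF S T'])
  have T'T: "is_adjoint ip1 ip2 T' T" using swap.is_adjoint_commute[OF TT'] .
  interpret S: Vector_Spaces.linear s1 s2 S using S by (simp add: bounded_operator_def)
  interpret T: Vector_Spaces.linear s2 s1 T using T by (simp add: bounded_operator_def)
  interpret T': Vector_Spaces.linear s1 s2 T' using T' by (simp add: bounded_operator_def)
  interpret A: Vector_Spaces.linear s1 s2 A using A by (simp add: bounded_operator_def)
  have closedN: "closed (null_space S)" "closed (null_space T)" "closed (null_space T')"
    using S T T' by (auto simp: bounded_operator_def intro: closed_null_space)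
  have RT: "range T \<subseteq> null_space S" and RS: "range S \<subseteq> null_space T"
    using ST TS by (auto simp: null_space_def)
  have orth: "ip2 (T' x) (S z) = 0" for x z
    using T'T TS by (simp add: is_adjoint_def)
  have null_A: "null_space A = null_space S \<inter> null_space T'"
  proof -
    have "S x = 0 \<and> T' x = 0" if "S x + T' x = 0" for x
    proof -
      have "ip2 (S x + T' x) (S x) = ip2 (S x) (S x)" using orth by (simp add: H2.ip_add_left)
      then have "S x = 0" using that by simp
      then show ?thesis using that by simp
    qed
    then show ?thesis by (auto simp: null_space_def A_def)
  qed
  \<comment> \<open>The orthogonal complement of \<open>N(T')\<close> is the closure of \<open>R(T)\<close>, which lies in the closed subspace \<open>N(S)\<close>.\<close>
  have split: "\<exists>p q. x = p + q \<and> T' p = 0 \<and> S q = 0" for x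
  proof -
    obtain p where p: "p \<in> null_space T'" "x - p \<in> orthogonal_complement ip1 (null_space T')"
      using H1.orthogonal_decomposition[OF closedN(3) T'.subspace_null_space, of x] .
    have "orthogonal_complement ip1 (null_space T') \<subseteq> null_space S"
      unfolding swap.null_space_adjoint[OF TT']
      using H1.orthogonal_complement_antimono[OF H1.orthogonal_complement_antimono[OF RT]]
        H1.orthogonal_complement_twice[OF closedN(1) S.subspace_null_space] by simp
    then have "S (x - p) = 0" using p(2) by (auto simp: null_space_def)
    moreover have "T' p = 0" using p(1) by (simp add: null_space_def)
    ultimately show ?thesis by (intro exI[of _ p] exI[of _ "x - p"]) simp
  qed
  have RSA: "range S \<subseteq> range A" and RTA: "range T' \<subseteq> range A"
  proof -
    have "S x \<in> range A \<and> T' x \<in> range A" for x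
    proof -
      obtain p q where pq: "x = p + q" "T' p = 0" "S q = 0" using split by blast
      then have "S x = A p" "T' x = A q" by (auto simp: A_def S.add T'.add)
      then show ?thesis by simp
    qed
    then show "range S \<subseteq> range A" "range T' \<subseteq> range A" by auto
  qed
  have null_T_range_A: "null_space T \<inter> range A = range S"
  proof -
    have "A x \<in> range S" if "T (A x) = 0" for x
    proof -
      have "T (T' x) = 0" using that TS by (simp add: A_def T.add)
      moreover have "ip2 (T' x) (T' x) = ip1 x (T (T' x))" using T'T unfolding is_adjoint_def by blast
      ultimately have "T' x = 0" by simp
      then show ?thesis by (simp add: A_def)
    qed
    then show ?thesis using RS RSA by (auto simp: null_space_def)
  qed
  have closed_range_T': "closed (range T')"
    if "finite_over s1 (null_space S) (range T) \<or> finite_over s2 UNIV (range A)"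
    using that
  proof
    assume "finite_over s1 (null_space S) (range T)"
    then show ?thesis
      using swap.closed_range_adjoint[OF T TT' closedN(1) S.subspace_null_space RT] by blast
  next
    assume "finite_over s2 UNIV (range A)"
    then have "closed (range A)" by (rule closed_range_of_finite_codim[OF A])
    \<comment> \<open>A vector \<open>A x\<close> orthogonal to \<open>R(S)\<close> has \<open>S x = 0\<close>.\<close>
    moreover have "range T' = range A \<inter> orthogonal_complement ip2 (range S)"
    proof -
      have "A x \<in> range T'" if "ip2 (A x) (S x) = 0" for x
      proof -
        have "ip2 (S x) (S x) = 0" using that orth by (simp add: A_def H2.ip_add_left)
        then show ?thesis by (simp add: A_def)
      qed
      then show ?thesis using RTA orth by (auto simp: orthogonal_complement_def)
    qed
    ultimately show ?thesis using H2.closed_orthogonal_complement by (simp add: closed_Int)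
  qed
  have main: "(finite_over s1 (null_space S) (range T) \<longleftrightarrow> finite_over s1 (null_space A) {0})
      \<and> (finite_over s2 (null_space T) (range S) \<longleftrightarrow> finite_over s2 UNIV (range A))
      \<and> (finite_over s1 (null_space S) (range T) \<longrightarrow>
          dim_quotient s1 (null_space S) (range T) = dim_quotient s1 (null_space A) {0})
      \<and> (finite_over s2 UNIV (range A) \<longrightarrow>
          dim_quotient s2 (null_space T) (range S) = dim_quotient s2 UNIV (range A))"
    if cl': "closed (range T')"
  proof -
    have cl: "closed (range T)"
      using cl' swap.closed_range_iff_closed_range_adjoint[OF T TT'] by simp
    have genS: "null_space S \<subseteq> H1.span (null_space A \<union> range T)"
    proof
      fix x assume x: "x \<in> null_space S"
      obtain p where p: "p \<in> range T" "x - p \<in> orthogonal_complement ip1 (range T)"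
        using H1.orthogonal_decomposition[OF cl T.subspace_range, of x] .
      have "x - p \<in> null_space S" using x p(1) RT S.subspace_null_space by (meson H1.subspace_diff subsetD)
      moreover have "x - p \<in> null_space T'" using p(2) swap.null_space_adjoint[OF TT'] by simp
      ultimately have "x - p \<in> H1.span (null_space A \<union> range T)"
        unfolding null_A by (intro H1.span_base) simp
      moreover have "p \<in> H1.span (null_space A \<union> range T)" using p(1) by (intro H1.span_base) simp
      ultimately have "(x - p) + p \<in> H1.span (null_space A \<union> range T)" by (rule H1.span_add)
      then show "x \<in> H1.span (null_space A \<union> range T)" by simp
    qed
    have genT: "UNIV \<subseteq> H2.span (null_space T \<union> range A)"
    proof
      fix y
      obtain p where p: "p \<in> null_space T" "y - p \<in> orthogonal_complement ip2 (null_space T)"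
        using H2.orthogonal_decomposition[OF closedN(2) T.subspace_null_space, of y] .
      have "y - p \<in> range A"
        using p(2) closed_range_eq_orthogonal_complement[OF T' T'T cl'] RTA by blast
      then have "y - p \<in> H2.span (null_space T \<union> range A)" by (intro H2.span_base) simp
      moreover have "p \<in> H2.span (null_space T \<union> range A)" using p(1) by (intro H2.span_base) simp
      ultimately have "(y - p) + p \<in> H2.span (null_space T \<union> range A)" by (rule H2.span_add)
      then show "y \<in> H2.span (null_space T \<union> range A)" by simp
    qed
    have int0: "null_space A \<inter> range T = {0}"
    proof -
      have "x = 0" if "T' x = 0" "x \<in> range T" for x
      proof -
        have "x \<in> orthogonal_complement ip1 (range T)"
          using that(1) swap.null_space_adjoint[OF TT'] by (auto simp: null_space_def)
        then show ?thesis using that(2) H1.orthogonal_complement_Int by blast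
      qed
      moreover have "0 \<in> null_space A" "0 \<in> range T"
        using H1.subspace_0[OF A.subspace_null_space] H1.subspace_0[OF T.subspace_range] by auto
      ultimately show ?thesis using null_A by (auto simp: null_space_def)
    qed
    have NA: "null_space A \<subseteq> null_space S" using null_A by simp
    have f1: "finite_over s1 (null_space S) (range T) \<longleftrightarrow> finite_over s1 (null_space A) {0}"
    proof
      assume "finite_over s1 (null_space S) (range T)"
      then have "finite_over s1 (null_space A) (range T)" by (rule H1.finite_over_mono[OF _ NA order_refl])
      then show "finite_over s1 (null_space A) {0}"
        using H1.finite_over_Int[OF A.subspace_null_space T.subspace_range] int0 by simp
    next
      assume "finite_over s1 (null_space A) {0}"
      then obtain F where F: "finite F" "null_space A \<subseteq> H1.span ({0} \<union> F)"
        by (auto simp: finite_over_def)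
      have "H1.span ({0} \<union> F) \<subseteq> H1.span (range T \<union> F)"
        using H1.subspace_0[OF T.subspace_range] by (intro H1.span_mono) auto
      then have "H1.span (null_space A \<union> range T) \<subseteq> H1.span (range T \<union> F)"
        using F(2) by (intro H1.span_minimal) (auto intro: H1.span_base)
      then show "finite_over s1 (null_space S) (range T)"
        using F(1) genS unfolding finite_over_def by blast
    qed
    have f2: "finite_over s2 (null_space T) (range S) \<longleftrightarrow> finite_over s2 UNIV (range A)"
    proof
      assume "finite_over s2 (null_space T) (range S)"
      then obtain F where F: "finite F" "null_space T \<subseteq> H2.span (range S \<union> F)"
        by (auto simp: finite_over_def)
      have "H2.span (range S \<union> F) \<subseteq> H2.span (range A \<union> F)"
        using RSA by (intro H2.span_mono) auto
      then have "H2.span (null_space T \<union> range A) \<subseteq> H2.span (range A \<union> F)"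
        using F(2) by (intro H2.span_minimal) (auto intro: H2.span_base)
      then show "finite_over s2 UNIV (range A)"
        using F(1) genT unfolding finite_over_def by blast
    next
      assume "finite_over s2 UNIV (range A)"
      then have "finite_over s2 (null_space T) (range A)" by (rule H2.finite_over_mono) auto
      then show "finite_over s2 (null_space T) (range S)"
        using H2.finite_over_Int[OF T.subspace_null_space A.subspace_range] null_T_range_A by simp
    qed
    have d1: "dim_quotient s1 (null_space S) (range T) = dim_quotient s1 (null_space A) {0}"
      if "finite_over s1 (null_space S) (range T)"
      using H1.dim_quotient_sum_eq[OF S.subspace_null_space A.subspace_null_space T.subspace_range
          NA RT genS H1.finite_over_mono[OF that NA order_refl]] int0 by simp
    have d2: "dim_quotient s2 (null_space T) (range S) = dim_quotient s2 UNIV (range A)"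
      if "finite_over s2 UNIV (range A)"
      using H2.dim_quotient_sum_eq[OF H2.subspace_UNIV T.subspace_null_space A.subspace_range
          subset_UNIV subset_UNIV genT H2.finite_over_mono[OF that subset_UNIV order_refl]] null_T_range_A
      by simp
    show ?thesis using f1 f2 d1 d2 by blast
  qed
  have pair: "fredholm_pair s1 s2 S T \<longleftrightarrow>
      finite_over s1 (null_space S) (range T) \<and> finite_over s2 (null_space T) (range S)"
    using fredholm_pair_iff[OF S T] H1.finite_over_subset[OF RT] H2.finite_over_subset[OF RS]
    by (auto simp: commensurable_def)
  have oper: "fredholm_operator s1 s2 A \<longleftrightarrow>
      finite_over s1 (null_space A) {0} \<and> finite_over s2 UNIV (range A)"
    using fredholm_operator_iff[OF A] H2.finite_over_subset[of "range A" UNIV]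
      H1.finite_over_subset[of "{0}" "null_space A"] H1.subspace_0[OF A.subspace_null_space]
    by (auto simp: commensurable_def)
  show iff: "fredholm_pair s1 s2 S T \<longleftrightarrow> fredholm_operator s1 s2 A"
    unfolding pair oper using main closed_range_T' by blast
  assume P: "fredholm_pair s1 s2 S T"
  then have cl: "closed (range T')" using closed_range_T' pair by blast
  have "null_space S \<inter> range T = range T" "null_space T \<inter> range S = range S"
    "null_space A \<inter> {0} = {0}"
    using RT RS H1.subspace_0[OF A.subspace_null_space] by auto
  then have "pair_index s1 s2 S T =
      int (dim_quotient s1 (null_space S) (range T)) - int (dim_quotient s2 (null_space T) (range S))"
    using H1.dim_quotient_self[OF T.subspace_range] H2.dim_quotient_self[OF S.subspace_range]
    by (simp add: pair_index_def)
  also have "\<dots> = int (dim_quotient s1 (null_space A) {0}) - int (dim_quotient s2 UNIV (range A))"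
    using main[OF cl] P pair by auto
  also have "\<dots> = operator_index s1 s2 A"
    using H1.dim_eq_dim_quotient_0[OF A.subspace_null_space] P iff oper
    by (simp add: operator_index_def)
  finally show "pair_index s1 s2 S T = operator_index s1 s2 A" .
qed

section \<open>Reduction to vanishing products\<close>

text \<open>
  Composing \<open>S\<close> with the orthogonal projection onto \<open>N(T S)\<close> gives \<open>S1\<close> with \<open>T S1 = 0\<close>, while \<open>S1 T\<close> still has
  finite rank. Projecting the values of \<open>S1\<close> away from \<open>R(S1 T)\<close> kills this product. It preserves
  \<open>T S1 = 0\<close> because \<open>R(S1 T)\<close> is contained in \<open>N(T)\<close>.
\<close>

lemma exact_perturbation_exists:
  assumes S: "bounded_operator s1 s2 S" and T: "bounded_operator s2 s1 T"
    and TS: "finite_over s1 (range (T \<circ> S)) {0}" and ST: "finite_over s2 (range (S \<circ> T)) {0}"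
  obtains S' W where "bounded_operator s1 s2 S'" "\<And>x. T (S' x) = 0" "\<And>y. S' (T y) = 0"
    "H1.subspace W" "finite_over s1 UNIV W" "\<And>x. x \<in> W \<Longrightarrow> S' x = S x"
proof -
  let ?N = "null_space (T \<circ> S)"
  have bTS: "bounded_operator s1 s1 (T \<circ> S)" and bST: "bounded_operator s2 s2 (S \<circ> T)"
    using S T by (auto intro: bounded_operator_compose)
  interpret T: Vector_Spaces.linear s2 s1 T using T by (simp add: bounded_operator_def)
  interpret TS: Vector_Spaces.linear s1 s1 "T \<circ> S" using bTS by (simp add: bounded_operator_def)
  have N: "closed ?N" "H1.subspace ?N" "finite_over s1 UNIV ?N"
    using bTS TS.subspace_null_space TS.finite_over_UNIV_null_space[OF TS]
    by (auto simp: bounded_operator_def intro: closed_null_space)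
  obtain P where P: "bounded_operator s1 s1 P" "\<And>x. P x \<in> ?N" "\<And>x. x \<in> ?N \<Longrightarrow> P x = x"
    using H1.orthogonal_projection_exists[OF N(1,2)] by metis
  define S1 where "S1 = S \<circ> P"
  have S1: "bounded_operator s1 s2 S1" unfolding S1_def by (rule bounded_operator_compose[OF P(1) S])
  have TS1: "T (S1 x) = 0" for x using P(2)[of x] by (simp add: S1_def null_space_def)
  have bS1T: "bounded_operator s2 s2 (S1 \<circ> T)" by (rule bounded_operator_compose[OF T S1])
  let ?R = "range (S1 \<circ> T)"
  interpret S1T: Vector_Spaces.linear s2 s2 "S1 \<circ> T" using bS1T by (simp add: bounded_operator_def)
  have "finite_over s2 ?R {0}"
  proof -
    have "bounded_operator s2 s1 ((T \<circ> S) \<circ> T)" by (rule bounded_operator_compose[OF T bTS])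
    then interpret TST: Vector_Spaces.linear s2 s1 "(T \<circ> S) \<circ> T" by (simp add: bounded_operator_def)
    have "range ((T \<circ> S) \<circ> T) \<subseteq> range (T \<circ> S)" by auto
    then have "finite_over s1 (range ((T \<circ> S) \<circ> T)) {0}" using H1.finite_over_mono[OF TS] by blast
    then have cofin: "finite_over s2 UNIV (null_space ((T \<circ> S) \<circ> T))"
      by (rule TST.finite_over_UNIV_null_space)
    \<comment> \<open>The maps \<open>S1 T\<close> and \<open>S T\<close> agree where \<open>T\<close> takes values in \<open>N(T S)\<close>, a subspace of finite codimension.\<close>
    have "(S1 \<circ> T) y = (S \<circ> T) y" if "y \<in> null_space ((T \<circ> S) \<circ> T)" for y
      using that P(3)[of "T y"] by (simp add: S1_def null_space_def)
    then have "commensurable s2 ?R (range (S \<circ> T))"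
      using bS1T bST unfolding bounded_operator_def
      by (intro linear_agree_finite_codim(2)[OF _ _ TST.subspace_null_space cofin]) simp_all
    then show ?thesis using ST H2.finite_over_trans unfolding commensurable_def by blast
  qed
  note R = this S1T.subspace_range H2.closed_finite_dimensional[OF S1T.subspace_range this]
  obtain Q where Q: "bounded_operator s2 s2 Q" "\<And>y. Q y \<in> ?R" "\<And>y. y \<in> ?R \<Longrightarrow> Q y = y"
    using H2.orthogonal_projection_exists[OF R(3,2)] by metis
  have QS1: "bounded_operator s1 s2 (Q \<circ> S1)" by (rule bounded_operator_compose[OF S1 Q(1)])
  interpret QS1: Vector_Spaces.linear s1 s2 "Q \<circ> S1" using QS1 by (simp add: bounded_operator_def)
  interpret vector_space_pair s1 s2 ..
  define S2 where "S2 = (\<lambda>x. S1 x - (Q \<circ> S1) x)"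
  have "bounded_operator s1 s2 S2"
    using linear_compose_sub[of S1 "Q \<circ> S1"] bounded_linear_sub[of S1 "Q \<circ> S1"] S1 QS1
    by (simp add: bounded_operator_def S2_def)
  moreover have "T (S2 x) = 0" for x
  proof -
    have "T (Q (S1 x)) = 0" using Q(2)[of "S1 x"] TS1 by auto
    then show ?thesis using TS1 by (simp add: S2_def T.diff)
  qed
  moreover have "S2 (T y) = 0" for y
    using Q(3)[of "S1 (T y)"] by (simp add: S2_def)
  moreover have "H1.subspace (?N \<inter> null_space (Q \<circ> S1))"
    using N(2) QS1.subspace_null_space by (rule H1.subspace_inter)
  moreover have "finite_over s1 UNIV (?N \<inter> null_space (Q \<circ> S1))"
  proof -
    have "range (Q \<circ> S1) \<subseteq> ?R" using Q(2) by auto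
    then have "finite_over s2 (range (Q \<circ> S1)) {0}" using H2.finite_over_mono[OF R(1)] by blast
    then show ?thesis
      using H1.finite_over_Int_UNIV[OF N(2) QS1.subspace_null_space N(3)]
        QS1.finite_over_UNIV_null_space by blast
  qed
  moreover have "S2 x = S x" if "x \<in> ?N \<inter> null_space (Q \<circ> S1)" for x
    using that P(3)[of x] by (simp add: S2_def S1_def null_space_def)
  ultimately show thesis by (rule that)
qed

text \<open>
  Replacing \<open>S\<close> by \<open>R\<close> with \<open>T R = 0\<close> and \<open>R T = 0\<close> changes both sides only by a perturbation of finite
  rank, and \<open>fredholm_pair_exact\<close> applies to \<open>R\<close>.
\<close>

lemma fredholm_pair_operator:
  assumes S: "bounded_operator s1 s2 S" and T: "bounded_operator s2 s1 T"
    and TS: "finite_over s1 (range (T \<circ> S)) {0}" and ST: "finite_over s2 (range (S \<circ> T)) {0}"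
  defines "A \<equiv> \<lambda>x. S x + hilbert_adjoint ip2 ip1 T x"
  shows "fredholm_pair s1 s2 S T \<longleftrightarrow> fredholm_operator s1 s2 A"
    and "fredholm_pair s1 s2 S T \<Longrightarrow> pair_index s1 s2 S T = operator_index s1 s2 A"
proof -
  interpret swap: hilbert_pair s2 ip2 s1 ip1
    by (rule hilbert_pair_commute) (rule hilbert_pair_axioms)
  let ?T' = "hilbert_adjoint ip2 ip1 T"
  have TT': "is_adjoint ip2 ip1 T ?T'" by (rule swap.is_adjoint_hilbert_adjoint[OF T])
  have T': "bounded_operator s1 s2 ?T'" by (rule swap.bounded_operator_adjoint[OF T TT'])
  obtain R W where R: "bounded_operator s1 s2 R" "\<And>x. T (R x) = 0" "\<And>y. R (T y) = 0"
    and W: "H1.subspace W" "finite_over s1 UNIV W" "\<And>x. x \<in> W \<Longrightarrow> R x = S x"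
    using exact_perturbation_exists[OF S T TS ST] by metis
  define B where "B = (\<lambda>x. R x + ?T' x)"
  have A: "bounded_operator s1 s2 A" unfolding A_def by (rule bounded_operator_add[OF S T'])
  have B: "bounded_operator s1 s2 B" unfolding B_def by (rule bounded_operator_add[OF R(1) T'])
  note exact = fredholm_pair_exact[OF R(1) T TT' R(2,3), folded B_def]
  have linear: "Vector_Spaces.linear s1 s2 S" "Vector_Spaces.linear s1 s2 R"
      "Vector_Spaces.linear s1 s2 A" "Vector_Spaces.linear s1 s2 B"
    using S R(1) A B by (simp_all add: bounded_operator_def)
  interpret S: Vector_Spaces.linear s1 s2 S by fact
  interpret R: Vector_Spaces.linear s1 s2 R by fact
  interpret A: Vector_Spaces.linear s1 s2 A by fact
  interpret B: Vector_Spaces.linear s1 s2 B by fact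
  interpret T: Vector_Spaces.linear s2 s1 T using T by (simp add: bounded_operator_def)
  have SR: "S x = R x" "A x = B x" if "x \<in> W" for x
    using W(3)[OF that] by (simp_all add: A_def B_def)
  note cS = linear_agree_finite_codim[OF linear(1,2) W(1,2) SR(1)]
  note cA = linear_agree_finite_codim[OF linear(3,4) W(1,2) SR(2)]
  have pair: "fredholm_pair s1 s2 S T \<longleftrightarrow> fredholm_pair s1 s2 R T"
    unfolding fredholm_pair_iff[OF S T] fredholm_pair_iff[OF R(1) T]
    using H1.commensurable_cong[OF cS(1)] H2.commensurable_cong[OF cS(2)] by simp
  have oper: "fredholm_operator s1 s2 A \<longleftrightarrow> fredholm_operator s1 s2 B"
    unfolding fredholm_operator_iff[OF A] fredholm_operator_iff[OF B]
    using H1.commensurable_cong[OF cA(1)] H2.commensurable_cong[OF cA(2)] by simp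
  show iff: "fredholm_pair s1 s2 S T \<longleftrightarrow> fredholm_operator s1 s2 A"
    unfolding pair oper by (rule exact(1))
  assume P: "fredholm_pair s1 s2 S T"
  have PR: "commensurable s1 (null_space R) (range T)" "commensurable s2 (range R) (null_space T)"
    using P pair fredholm_pair_iff[OF R(1) T] by auto
  have FB: "fredholm_operator s1 s2 B" and FA: "fredholm_operator s1 s2 A"
    using P iff oper by auto
  then have PB: "commensurable s1 (null_space B) {0}" "commensurable s2 (range B) UNIV"
    using fredholm_operator_iff[OF B] by auto
  have "pair_index s1 s2 S T = pair_index s1 s2 R T"
    unfolding pair_index_eq
    using cS(3)
      H1.relative_dim_trans[OF S.subspace_null_space R.subspace_null_space T.subspace_range cS(1) PR(1)]
      H2.relative_dim_trans[OF S.subspace_range R.subspace_range T.subspace_null_space cS(2) PR(2)]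
    by simp
  also have "\<dots> = operator_index s1 s2 B" using P pair by (intro exact(2)) simp
  also have "\<dots> = operator_index s1 s2 A"
    unfolding operator_index_eq[OF FA] operator_index_eq[OF FB]
    using cA(3)
      H1.relative_dim_trans[OF A.subspace_null_space B.subspace_null_space H1.subspace_single_0 cA(1) PB(1)]
      H2.relative_dim_trans[OF A.subspace_range B.subspace_range H2.subspace_UNIV cA(2) PB(2)]
    by simp
  finally show "pair_index s1 s2 S T = operator_index s1 s2 A" .
qed

end

theorem theorem4p2:
  fixes s1 :: "'k::real_or_complex_field \<Rightarrow> 'a::banach \<Rightarrow> 'a"
    and ip1 :: "'a \<Rightarrow> 'a \<Rightarrow> 'k"
    and s2 :: "'k \<Rightarrow> 'b::banach \<Rightarrow> 'b"
    and ip2 :: "'b \<Rightarrow> 'b \<Rightarrow> 'k"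
    and S :: "'a \<Rightarrow> 'b"
    and T :: "'b \<Rightarrow> 'a"
  assumes "hilbert_space s1 ip1"
    and "hilbert_space s2 ip2"
    and "bounded_operator s1 s2 S"
    and "bounded_operator s2 s1 T"
    and "fin_dim s1 (range (T \<circ> S))"
    and "fin_dim s2 (range (S \<circ> T))"
  shows "(fredholm_pair s1 s2 S T \<longleftrightarrow>
            fredholm_operator s1 s2 (\<lambda>x. S x + hilbert_adjoint ip2 ip1 T x)) \<and>
         (fredholm_operator s1 s2 (\<lambda>x. S x + hilbert_adjoint ip2 ip1 T x) \<longleftrightarrow>
            fredholm_operator s2 s1 (\<lambda>y. T y + hilbert_adjoint ip1 ip2 S y)) \<and>
         (fredholm_pair s1 s2 S T \<longrightarrow>
            pair_index s1 s2 S T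
              = operator_index s1 s2 (\<lambda>x. S x + hilbert_adjoint ip2 ip1 T x) \<and>
            pair_index s1 s2 S T
              = - operator_index s2 s1 (\<lambda>y. T y + hilbert_adjoint ip1 ip2 S y))"
proof -
  interpret H1: hilbert_space s1 ip1 by fact
  interpret H2: hilbert_space s2 ip2 by fact
  interpret hilbert_pair s1 ip1 s2 ip2 ..
  interpret swap: hilbert_pair s2 ip2 s1 ip1 ..
  have bdd: "bounded_operator s1 s1 (T \<circ> S)" "bounded_operator s2 s2 (S \<circ> T)"
    using assms(3,4) by (auto intro: bounded_operator_compose)
  interpret TS: Vector_Spaces.linear s1 s1 "T \<circ> S" using bdd(1) by (simp add: bounded_operator_def)
  interpret ST: Vector_Spaces.linear s2 s2 "S \<circ> T" using bdd(2) by (simp add: bounded_operator_def)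
  have TS: "finite_over s1 (range (T \<circ> S)) {0}"
    using assms(5) H1.fin_dim_iff_finite_over_0[OF TS.subspace_range] by simp
  have ST: "finite_over s2 (range (S \<circ> T)) {0}"
    using assms(6) H2.fin_dim_iff_finite_over_0[OF ST.subspace_range] by simp
  note direct = fredholm_pair_operator[OF assms(3,4) TS ST]
  note swapped = swap.fredholm_pair_operator[OF assms(4,3) ST TS]
  show ?thesis
    using direct swapped fredholm_pair_commute[of s1 s2 S T] pair_index_commute[of s1 s2 S T] by simp
qed

end
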